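(* Assuming the strong exponential time hypothesis (SETH), for no $\epsilon>0$ is there an algorithm that solves \textsc{Colorful Graph Motif} in $(2-\epsilon)^{\ell}\cdot n^{\mathcal{O}(1)}$ time, where $n=|V|$ and $\ell=|V|-|M|$.
   Context: \textsc{Colorful Graph Motif} (CGM): the input is a set $M$ of colors (built from a color set $C$), an undirected graph $G=(V,E)$, and a coloring $\chi:V\to C$; the question is whether there is a set $S\subseteq V$ such that $G[S]$ is connected and there is a one-to-one mapping $f:S\to M$ with $f(v)=\chi(v)$ for all $v\in S$ (i.e. $S$ contains exactly one vertex of each color of $M$ and no other vertices). The parameter is $\ell:=|V|-|M|$. SETH: for every $\epsilon>0$, CNF-SAT cannot be solved in $(2-\epsilon)^{r}\cdot|\Phi|^{\mathcal{O}(1)}$ time, where $\Phi$ is the input formula and $r$ its number of variables. *)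

theory Defs
  imports
    Complex_Main
    "HOL-Computational_Algebra.Polynomial"
    "Graph_Theory.Graph_Theory"
begin

section \<open>Model of computation\<close>

text \<open>
  Algorithms are programs of the WHILE language over binary trees (N. D. Jones,
  \<^emph>\<open>Computability and Complexity from a Programming Perspective\<close>): variables hold trees, the
  only data operations are the constant \<open>nil\<close>, pairing and the two projections, and the only test
  is the test for \<open>nil\<close>. Each operation costs one time unit. Since a tree is handled through a
  pointer to its root, a step is a constant number of pointer operations; conversely a
  logarithmic-cost random access machine is simulated with an overhead factor polylogarithmic in
  the running time. Such a
  factor is absorbed by the polynomial in a bound of the form \<open>(2 - \<epsilon>)\<^sup>\<ell> \<cdot> poly(n)\<close>, so these
  bounds are achievable in one of the two models iff they are in the other.
\<close>

datatype data = Nl | Node data data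

fun fst_data :: "data \<Rightarrow> data" where
  "fst_data Nl = Nl"
| "fst_data (Node a b) = a"

fun snd_data :: "data \<Rightarrow> data" where
  "snd_data Nl = Nl"
| "snd_data (Node a b) = b"

datatype expr = Var nat | Nil_E | Pair_E expr expr | Fst_E expr | Snd_E expr

type_synonym store = "nat \<Rightarrow> data"

fun eval_expr :: "expr \<Rightarrow> store \<Rightarrow> data" where
  "eval_expr (Var x) s = s x"
| "eval_expr Nil_E s = Nl"
| "eval_expr (Pair_E e f) s = Node (eval_expr e s) (eval_expr f s)"
| "eval_expr (Fst_E e) s = fst_data (eval_expr e s)"
| "eval_expr (Snd_E e) s = snd_data (eval_expr e s)"

fun expr_cost :: "expr \<Rightarrow> nat" where
  "expr_cost (Var x) = 1"
| "expr_cost Nil_E = 1"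
| "expr_cost (Pair_E e f) = expr_cost e + expr_cost f + 1"
| "expr_cost (Fst_E e) = expr_cost e + 1"
| "expr_cost (Snd_E e) = expr_cost e + 1"

datatype prog = Asgn nat expr | Seq prog prog | Cond expr prog prog | Loop expr prog

text \<open>\<open>exec p s t s'\<close>: program \<open>p\<close>, started in store \<open>s\<close>, halts after \<open>t\<close> steps in store \<open>s'\<close>.\<close>

inductive exec :: "prog \<Rightarrow> store \<Rightarrow> nat \<Rightarrow> store \<Rightarrow> bool" where
  Asgn: "exec (Asgn x e) s (expr_cost e + 1) (s(x := eval_expr e s))"
| Seq: "exec p s t s' \<Longrightarrow> exec q s' u s'' \<Longrightarrow> exec (Seq p q) s (t + u) s''"
| CondTrue: "eval_expr e s \<noteq> Nl \<Longrightarrow> exec p s t s' \<Longrightarrow>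
    exec (Cond e p q) s (expr_cost e + 1 + t) s'"
| CondFalse: "eval_expr e s = Nl \<Longrightarrow> exec q s t s' \<Longrightarrow>
    exec (Cond e p q) s (expr_cost e + 1 + t) s'"
| LoopFalse: "eval_expr e s = Nl \<Longrightarrow> exec (Loop e p) s (expr_cost e + 1) s"
| LoopTrue: "eval_expr e s \<noteq> Nl \<Longrightarrow> exec p s t s' \<Longrightarrow> exec (Loop e p) s' u s'' \<Longrightarrow>
    exec (Loop e p) s (expr_cost e + 1 + t + u) s''"

inductive_cases AsgnE: "exec (Asgn x e) s t s'"
inductive_cases SeqE: "exec (Seq p q) s t s'"
inductive_cases CondE: "exec (Cond e p q) s t s'"
inductive_cases LoopE: "exec (Loop e p) s t s'"

lemma exec_deterministic:
  "exec p s t s' \<Longrightarrow> exec p s u s'' \<Longrightarrow> t = u \<and> s' = s''"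
proof (induction arbitrary: u s'' rule: exec.induct)
  case (Asgn x e s)
  from Asgn.prems show ?case by (rule AsgnE) simp
next
  case (Seq p s t\<^sub>1 s\<^sub>1 q t\<^sub>2 s\<^sub>2)
  from Seq.prems obtain u\<^sub>1 r u\<^sub>2 where "u = u\<^sub>1 + u\<^sub>2" "exec p s u\<^sub>1 r" "exec q r u\<^sub>2 s''"
    by (rule SeqE)
  with Seq.IH(1)[of u\<^sub>1 r] Seq.IH(2)[of u\<^sub>2 s''] show ?case by simp
next
  case (CondTrue e s p t s' q)
  from CondTrue.prems CondTrue.hyps(1) obtain v where "u = expr_cost e + 1 + v" "exec p s v s''"
    by (elim CondE) simp_all
  with CondTrue.IH[of v s''] show ?case by simp
next
  case (CondFalse e s q t s' p)
  from CondFalse.prems CondFalse.hyps(1) obtain v where "u = expr_cost e + 1 + v" "exec q s v s''"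
    by (elim CondE) simp_all
  with CondFalse.IH[of v s''] show ?case by simp
next
  case (LoopFalse e s p)
  from LoopFalse.prems show ?case by (rule LoopE) (use LoopFalse.hyps in simp_all)
next
  case (LoopTrue e s p t\<^sub>1 s\<^sub>1 t\<^sub>2 s\<^sub>2)
  from LoopTrue.prems obtain u\<^sub>1 r u\<^sub>2 where
    "u = expr_cost e + 1 + u\<^sub>1 + u\<^sub>2" "exec p s u\<^sub>1 r" "exec (Loop e p) r u\<^sub>2 s''"
    by (rule LoopE) (use LoopTrue.hyps(1) in simp_all)
  with LoopTrue.IH(1)[of u\<^sub>1 r] LoopTrue.IH(2)[of u\<^sub>2 s''] show ?case by simp
qed

text \<open>The input is passed, and the answer returned, in variable 0.\<close>

definition init_store :: "data \<Rightarrow> store" where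
  "init_store d = (\<lambda>_. Nl)(0 := d)"

text \<open>
  The decision problem with instance set \<open>X\<close> and yes-instances \<open>{x \<in> X. Q x}\<close> is solved by a
  program that, on every instance \<open>x\<close> encoded as \<open>enc x\<close>, halts with the correct answer after at
  most \<open>T x\<close> steps.
\<close>

definition solvable_within ::
    "'i set \<Rightarrow> ('i \<Rightarrow> bool) \<Rightarrow> ('i \<Rightarrow> data) \<Rightarrow> ('i \<Rightarrow> real) \<Rightarrow> bool" where
  "solvable_within X Q enc T \<longleftrightarrow>
     (\<exists>p. \<forall>x\<in>X. \<exists>t s. exec p (init_store (enc x)) t s \<and> (s 0 \<noteq> Nl \<longleftrightarrow> Q x) \<and> real t \<le> T x)"

fun enc_bool :: "bool \<Rightarrow> data" where
  "enc_bool False = Nl"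
| "enc_bool True = Node Nl Nl"

fun enc_nat :: "nat \<Rightarrow> data" where
  "enc_nat 0 = Nl"
| "enc_nat (Suc n) = Node Nl (enc_nat n)"

fun enc_list :: "('a \<Rightarrow> data) \<Rightarrow> 'a list \<Rightarrow> data" where
  "enc_list f [] = Nl"
| "enc_list f (x # xs) = Node (f x) (enc_list f xs)"


section \<open>CNF-SAT and the strong exponential time hypothesis\<close>

text \<open>The literal \<open>(x, True)\<close> is the variable \<open>x\<close>, the literal \<open>(x, False)\<close> its negation.\<close>

type_synonym literal = "nat \<times> bool"
type_synonym cnf = "literal list list"

definition cnf_vars :: "cnf \<Rightarrow> nat set" where
  "cnf_vars \<Phi> = (\<Union>C\<in>set \<Phi>. fst ` set C)"

definition num_vars :: "cnf \<Rightarrow> nat" where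
  "num_vars \<Phi> = card (cnf_vars \<Phi>)"

definition cnf_size :: "cnf \<Rightarrow> nat" where
  "cnf_size \<Phi> = (\<Sum>C\<leftarrow>\<Phi>. length C + 1)"

definition cnf_satisfiable :: "cnf \<Rightarrow> bool" where
  "cnf_satisfiable \<Phi> \<longleftrightarrow>
     (\<exists>\<alpha> :: nat \<Rightarrow> bool. \<forall>C\<in>set \<Phi>. \<exists>(x, b)\<in>set C. \<alpha> x = b)"

text \<open>
  The variables of a formula are numbered consecutively. Hence numbers may be written in unary: the
  encoding has size polynomial in \<^const>\<open>cnf_size\<close>.
\<close>

definition cnf_instances :: "cnf set" where
  "cnf_instances = {\<Phi>. cnf_vars \<Phi> = {..<num_vars \<Phi>}}"

definition enc_literal :: "literal \<Rightarrow> data" where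
  "enc_literal l = Node (enc_nat (fst l)) (enc_bool (snd l))"

definition enc_cnf :: "cnf \<Rightarrow> data" where
  "enc_cnf \<Phi> = Node (enc_nat (num_vars \<Phi>)) (enc_list (enc_list enc_literal) \<Phi>)"

text \<open>
  A factor \<open>n\<close> to the power \<open>O(1)\<close> in a running time is a polynomial in \<open>n\<close>; coefficients are
  natural numbers, so that the polynomial is nonnegative.
\<close>

definition SETH :: bool where
  "SETH \<longleftrightarrow> (\<forall>\<epsilon>::real. \<epsilon> > 0 \<longrightarrow> \<not> (\<exists>q :: nat poly.
     solvable_within cnf_instances cnf_satisfiable enc_cnf
       (\<lambda>\<Phi>. (2 - \<epsilon>) ^ num_vars \<Phi> * real (poly q (cnf_size \<Phi>)))))"


section \<open>Colorful Graph Motif\<close>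

record cgm =
  cgm_motif :: "nat set"
  cgm_graph :: "nat pair_pre_digraph"
  cgm_coloring :: "nat \<Rightarrow> nat"

definition cgm_verts :: "cgm \<Rightarrow> nat set" where
  "cgm_verts I = pverts (cgm_graph I)"

definition cgm_colors :: "cgm \<Rightarrow> nat set" where
  "cgm_colors I = cgm_motif I \<union> cgm_coloring I ` cgm_verts I"

text \<open>
  Vertices, and the colors that occur in the motif or on a vertex, are numbered consecutively. The
  condition \<open>|M| \<le> |V|\<close> says that the parameter \<open>\<ell> = |V| - |M|\<close> is a natural number; it also bounds
  the number of colors by \<open>2 |V|\<close>, so that the encoding below has size polynomial in \<open>|V|\<close>.
\<close>

definition cgm_instances :: "cgm set" where
  "cgm_instances = {I. pair_graph (cgm_graph I)
     \<and> cgm_verts I = {..<card (cgm_verts I)}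
     \<and> cgm_colors I = {..<card (cgm_colors I)}
     \<and> card (cgm_motif I) \<le> card (cgm_verts I)}"

definition cgm_param :: "cgm \<Rightarrow> nat" where
  "cgm_param I = card (cgm_verts I) - card (cgm_motif I)"

text \<open>
  A connected graph has at least one vertex by definition of \<^const>\<open>Digraph_Component.connected\<close>, so an instance
  with empty motif is a no-instance.
\<close>

definition cgm_solvable :: "cgm \<Rightarrow> bool" where
  "cgm_solvable I \<longleftrightarrow>
     (\<exists>S \<subseteq> cgm_verts I.
        Digraph_Component.connected (with_proj (cgm_graph I) \<restriction> S)
        \<and> (\<exists>f. bij_betw f S (cgm_motif I) \<and> (\<forall>v\<in>S. f v = cgm_coloring I v)))"

text \<open>
  Adjacency matrix, list of vertex colors, and characteristic vector of the motif.
\<close>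

definition enc_cgm :: "cgm \<Rightarrow> data" where
  "enc_cgm I =
     (let n = card (cgm_verts I); k = card (cgm_colors I) in
      Node (enc_list (\<lambda>u. enc_list (\<lambda>v. enc_bool ((u, v) \<in> parcs (cgm_graph I))) [0..<n]) [0..<n])
        (Node (enc_list (\<lambda>v. enc_nat (cgm_coloring I v)) [0..<n])
          (enc_list (\<lambda>c. enc_bool (c \<in> cgm_motif I)) [0..<k])))"

end

theory Submission
  imports Defs
begin

text \<open>
  A formula with \<open>r\<close> variables and \<open>m\<close> clauses becomes a graph with a root, two literal vertices of
  the same color per variable, and one clause vertex per clause; root and clause vertices have
  private colors. The root is adjacent to all literals, and a clause to the literals it contains.
  With all \<open>r + m + 1\<close> colors in the motif, a set \<open>S\<close> of the required colors contains the root, all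
  clauses and one literal of each variable, that is, an assignment; it is connected iff every clause
  is adjacent to a literal of the assignment. Since \<open>|V| = 2 r + m + 1\<close>, the parameter is \<open>\<ell> = r\<close>,
  so the base of the exponential is preserved.

  That WHILE programs compute the reduction in polynomial time follows from closure properties of
  the functions on trees with polynomially bounded time and output size, the main one being closure
  under folds with polynomially bounded accumulators.
\<close>

section \<open>Timed execution\<close>

definition halts_within :: "prog \<Rightarrow> store \<Rightarrow> nat \<Rightarrow> (store \<Rightarrow> bool) \<Rightarrow> bool" where
  "halts_within p s T P \<longleftrightarrow> (\<exists>t s'. exec p s t s' \<and> t \<le> T \<and> P s')"

lemma halts_within_mono:
  assumes "halts_within p s T P" "T \<le> U" "\<And>s'. P s' \<Longrightarrow> Q s'"
  shows "halts_within p s U Q"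
  using assms unfolding halts_within_def by (meson order_trans)

lemma halts_within_Asgn:
  assumes "P (s(x := eval_expr e s))" "expr_cost e + 1 \<le> T"
  shows "halts_within (Asgn x e) s T P"
  using assms exec.Asgn unfolding halts_within_def by blast

lemma halts_within_Seq:
  assumes "halts_within p s T P" "\<And>s'. P s' \<Longrightarrow> halts_within q s' U Q" "T + U \<le> V"
  shows "halts_within (Seq p q) s V Q"
proof -
  obtain t s' where p: "exec p s t s'" "t \<le> T" "P s'"
    using assms(1) unfolding halts_within_def by blast
  obtain u s'' where q: "exec q s' u s''" "u \<le> U" "Q s''"
    using assms(2)[OF p(3)] unfolding halts_within_def by blast
  have "t + u \<le> V" using p(2) q(2) assms(3) by linarith
  with exec.Seq[OF p(1) q(1)] q(3) show ?thesis unfolding halts_within_def by blast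
qed

lemma halts_within_Seq_Asgn:
  assumes "halts_within p (s(x := eval_expr e s)) T P" "expr_cost e + 1 + T \<le> U"
  shows "halts_within (Seq (Asgn x e) p) s U P"
proof (rule halts_within_Seq)
  show "halts_within (Asgn x e) s (expr_cost e + 1) (\<lambda>s'. s' = s(x := eval_expr e s))"
    by (rule halts_within_Asgn) simp_all
  show "halts_within p s' T P" if "s' = s(x := eval_expr e s)" for s'
    using assms(1) that by simp
qed (fact assms(2))

lemma halts_within_Cond:
  assumes "eval_expr e s \<noteq> Nl \<Longrightarrow> halts_within p s T P" "eval_expr e s = Nl \<Longrightarrow> halts_within q s T P"
    and "expr_cost e + 1 + T \<le> U"
  shows "halts_within (Cond e p q) s U P"
proof -
  have "\<exists>t s'. exec (Cond e p q) s (expr_cost e + 1 + t) s' \<and> t \<le> T \<and> P s'"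
  proof (cases "eval_expr e s = Nl")
    case True
    with assms(2) exec.CondFalse show ?thesis unfolding halts_within_def by blast
  next
    case False
    with assms(1) exec.CondTrue show ?thesis unfolding halts_within_def by blast
  qed
  with assms(3) show ?thesis
    unfolding halts_within_def by (meson add_left_mono order_trans)
qed

lemma halts_within_Loop_False:
  assumes "eval_expr e s = Nl" "P s" "expr_cost e + 1 \<le> T"
  shows "halts_within (Loop e p) s T P"
  using assms exec.LoopFalse unfolding halts_within_def by blast

lemma halts_within_Loop_True:
  assumes "eval_expr e s \<noteq> Nl" "halts_within p s T Q"
    and "\<And>s'. Q s' \<Longrightarrow> halts_within (Loop e p) s' U P" "expr_cost e + 1 + T + U \<le> V"
  shows "halts_within (Loop e p) s V P"
proof -
  obtain t s' where p: "exec p s t s'" "t \<le> T" "Q s'"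
    using assms(2) unfolding halts_within_def by blast
  obtain u s'' where loop: "exec (Loop e p) s' u s''" "u \<le> U" "P s''"
    using assms(3)[OF p(3)] unfolding halts_within_def by blast
  have "expr_cost e + 1 + t + u \<le> V" using p(2) loop(2) assms(4) by linarith
  with exec.LoopTrue[OF assms(1) p(1) loop(1)] loop(3) show ?thesis
    unfolding halts_within_def by blast
qed

lemma exec_time_pos: "exec p s t s' \<Longrightarrow> 0 < t"
  by (induction rule: exec.induct) auto

section \<open>Polynomial-time functions on trees\<close>

lemma poly_nat_mono: "m \<le> n \<Longrightarrow> poly q m \<le> poly q n" for q :: "nat poly"
  by (induction q) (auto intro!: add_mono mult_mono)

text \<open>
  Variables \<open>1, \<dots>, k\<close> are scratch space; their initial content is arbitrary, so that programs can
  be run one after the other.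
\<close>

definition computes :: "prog \<Rightarrow> nat \<Rightarrow> nat poly \<Rightarrow> (data \<Rightarrow> data) \<Rightarrow> bool" where
  "computes p k q f \<longleftrightarrow> (\<forall>s. halts_within p s (poly q (size (s 0)))
     (\<lambda>s'. s' 0 = f (s 0) \<and> (\<forall>i>k. s' i = s i)))"

text \<open>
  The bound on the size of the result does not follow from the bound on the time: repeated pairing
  of a tree with itself doubles its size in constant time.
\<close>

definition fptime :: "(data \<Rightarrow> data) \<Rightarrow> bool" where
  "fptime f \<longleftrightarrow> (\<exists>p k q. computes p k q f) \<and> (\<exists>r :: nat poly. \<forall>d. size (f d) \<le> poly r (size d))"

lemma fptimeI:
  assumes "\<And>s. halts_within p s (poly q (size (s 0))) (\<lambda>s'. s' 0 = f (s 0) \<and> (\<forall>i>k. s' i = s i))"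
    and "\<And>d. size (f d) \<le> poly r (size d)"
  shows "fptime f"
  using assms unfolding fptime_def computes_def by blast

lemma fptime_computesE:
  assumes "fptime f"
  obtains p k q where "computes p k q f"
  using assms unfolding fptime_def by blast

lemma fptime_sizeE:
  assumes "fptime f"
  obtains r :: "nat poly" where "\<And>d. size (f d) \<le> poly r (size d)"
  using assms unfolding fptime_def by blast

definition call :: "prog \<Rightarrow> expr \<Rightarrow> nat \<Rightarrow> prog" where
  "call p e x = Seq (Asgn 0 e) (Seq p (Asgn x (Var 0)))"

lemma halts_within_call:
  assumes "computes p k q f" "eval_expr e s = d" "k < x"
    and time: "poly q (size d) + expr_cost e + 3 \<le> T"
    and post: "\<And>s'. s' x = f d \<Longrightarrow> \<forall>i>k. i \<noteq> x \<longrightarrow> s' i = s i \<Longrightarrow> P s'"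
  shows "halts_within (call p e x) s T P"
proof -
  let ?s = "s(0 := eval_expr e s)" and ?computed = "\<lambda>s'. s' 0 = f d \<and> (\<forall>i>k. i \<noteq> 0 \<longrightarrow> s' i = s i)"
  have run: "halts_within p ?s (poly q (size d)) ?computed"
    using assms(1)[unfolded computes_def, THEN spec[of _ ?s]]
    by (rule halts_within_mono) (simp_all add: assms(2))
  have result: "halts_within (Asgn x (Var 0)) s' 2 P" if "?computed s'" for s'
    using that \<open>k < x\<close> by (intro halts_within_Asgn post) auto
  have "halts_within (Seq p (Asgn x (Var 0))) ?s (poly q (size d) + 2) P"
    using run result by (rule halts_within_Seq) simp_all
  then show ?thesis
    unfolding call_def by (rule halts_within_Seq_Asgn) (use time in linarith)
qed

lemma size_fst_data_le: "size (fst_data d) \<le> size d"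
  by (cases d) auto

lemma size_snd_data_le: "size (snd_data d) \<le> size d"
  by (cases d) auto

lemma fptime_eval_expr:
  assumes "\<And>s. eval_expr e s = f (s 0)" "\<And>d. size (f d) \<le> poly r (size d)"
  shows "fptime f"
  by (rule fptimeI[where p = "Asgn 0 e" and k = 0 and q = "[:expr_cost e + 1:]" and r = r])
    (auto intro: halts_within_Asgn simp: assms)

lemma fptime_id: "fptime (\<lambda>d. d)"
  by (rule fptime_eval_expr[where e = "Var 0" and r = "[:0, 1:]"]) auto

lemma fptime_Nl: "fptime (\<lambda>_. Nl)"
  by (rule fptime_eval_expr[where e = Nil_E and r = 0]) auto

lemma fptime_comp:
  assumes "fptime f" "fptime g"
  shows "fptime (\<lambda>d. g (f d))"
proof -
  obtain p k q where p: "computes p k q f"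
    by (rule fptime_computesE[OF assms(1)])
  obtain p' k' q' where p': "computes p' k' q' g"
    by (rule fptime_computesE[OF assms(2)])
  obtain r :: "nat poly" where f: "\<And>d. size (f d) \<le> poly r (size d)"
    using fptime_sizeE[OF assms(1)] by blast
  obtain r' :: "nat poly" where g: "\<And>d. size (g d) \<le> poly r' (size d)"
    using fptime_sizeE[OF assms(2)] by blast
  show ?thesis
  proof (rule fptimeI[where p = "Seq p p'" and k = "max k k'" and q = "q + pcompose q' r"
        and r = "pcompose r' r"])
    show "size (g (f d)) \<le> poly (pcompose r' r) (size d)" for d
      using order_trans[OF g poly_nat_mono[OF f]] by (simp add: poly_pcompose)
    fix s :: store
    show "halts_within (Seq p p') s (poly (q + pcompose q' r) (size (s 0)))
      (\<lambda>s'. s' 0 = g (f (s 0)) \<and> (\<forall>i>max k k'. s' i = s i))"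
    proof (rule halts_within_Seq)
      show "halts_within p s (poly q (size (s 0))) (\<lambda>s'. s' 0 = f (s 0) \<and> (\<forall>i>k. s' i = s i))"
        using p by (simp add: computes_def)
      fix s' assume s': "s' 0 = f (s 0) \<and> (\<forall>i>k. s' i = s i)"
      have "halts_within p' s' (poly q' (size (s' 0)))
          (\<lambda>s''. s'' 0 = g (s' 0) \<and> (\<forall>i>k'. s'' i = s' i))"
        using p' by (simp add: computes_def)
      then show "halts_within p' s' (poly q' (poly r (size (s 0))))
          (\<lambda>s''. s'' 0 = g (f (s 0)) \<and> (\<forall>i>max k k'. s'' i = s i))"
        by (rule halts_within_mono) (use s' f[of "s 0"] in \<open>auto simp: poly_nat_mono\<close>)
    qed (simp add: poly_pcompose)
  qed
qed

lemma fptime_fst_data: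
  assumes "fptime f"
  shows "fptime (\<lambda>d. fst_data (f d))"
proof (rule fptime_comp[OF assms])
  show "fptime fst_data"
    by (rule fptime_eval_expr[where e = "Fst_E (Var 0)" and r = "[:0, 1:]"])
      (auto simp: size_fst_data_le)
qed

lemma fptime_snd_data:
  assumes "fptime f"
  shows "fptime (\<lambda>d. snd_data (f d))"
proof (rule fptime_comp[OF assms])
  show "fptime snd_data"
    by (rule fptime_eval_expr[where e = "Snd_E (Var 0)" and r = "[:0, 1:]"])
      (auto simp: size_snd_data_le)
qed

definition pair_prog :: "prog \<Rightarrow> prog \<Rightarrow> nat \<Rightarrow> prog" where
  "pair_prog p p' K = Seq (Asgn K (Var 0)) (Seq (call p (Var K) (K + 1))
     (Seq (call p' (Var K) (K + 2)) (Asgn 0 (Pair_E (Var (K + 1)) (Var (K + 2))))))"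

lemma halts_within_pair_prog:
  assumes p: "computes p k q f" "k < K" and p': "computes p' k' q' g" "k' < K"
  shows "halts_within (pair_prog p p' K) s (poly q (size (s 0)) + poly q' (size (s 0)) + 14)
    (\<lambda>s'. s' 0 = Node (f (s 0)) (g (s 0)) \<and> (\<forall>i>K + 2. s' i = s i))"
proof -
  let ?d = "s 0" and ?saved = "s(K := eval_expr (Var 0) s)"
  let ?call_f = "call p (Var K) (K + 1)" and ?call_g = "call p' (Var K) (K + 2)"
    and ?pair = "Asgn 0 (Pair_E (Var (K + 1)) (Var (K + 2)))"
  let ?first = "\<lambda>s'. s' K = ?d \<and> s' (K + 1) = f ?d \<and> (\<forall>i>K + 2. s' i = s i)"
  let ?second = "\<lambda>s'. s' (K + 1) = f ?d \<and> s' (K + 2) = g ?d \<and> (\<forall>i>K + 2. s' i = s i)"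
  let ?paired = "\<lambda>s'. s' 0 = Node (f ?d) (g ?d) \<and> (\<forall>i>K + 2. s' i = s i)"
  have first: "halts_within ?call_f ?saved (poly q (size ?d) + 4) ?first"
    by (rule halts_within_call[OF p(1), where d = ?d]) (use p(2) in auto)
  have second: "halts_within ?call_g s' (poly q' (size ?d) + 4) ?second" if "?first s'" for s'
    by (rule halts_within_call[OF p'(1), where d = ?d]) (use that p'(2) in auto)
  have pair: "halts_within ?pair s' 4 ?paired" if "?second s'" for s'
    by (rule halts_within_Asgn) (use that in auto)
  have "halts_within (Seq ?call_g ?pair) s' (poly q' (size ?d) + 8) ?paired" if "?first s'" for s'
    using second[OF that] pair by (rule halts_within_Seq) simp_all
  with first have "halts_within (Seq ?call_f (Seq ?call_g ?pair)) ?saved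
      (poly q (size ?d) + poly q' (size ?d) + 12) ?paired"
    by (rule halts_within_Seq) simp_all
  then show ?thesis
    unfolding pair_prog_def by (rule halts_within_Seq_Asgn) simp
qed

lemma fptime_Node:
  assumes "fptime f" "fptime g"
  shows "fptime (\<lambda>d. Node (f d) (g d))"
proof -
  obtain p k q where p: "computes p k q f"
    by (rule fptime_computesE[OF assms(1)])
  obtain p' k' q' where p': "computes p' k' q' g"
    by (rule fptime_computesE[OF assms(2)])
  obtain r :: "nat poly" where f: "\<And>d. size (f d) \<le> poly r (size d)"
    using fptime_sizeE[OF assms(1)] by blast
  obtain r' :: "nat poly" where g: "\<And>d. size (g d) \<le> poly r' (size d)"
    using fptime_sizeE[OF assms(2)] by blast
  define K where "K = Suc (max k k')"
  have K: "k < K" "k' < K" by (auto simp: K_def)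
  show ?thesis
  proof (rule fptimeI)
    show "halts_within (pair_prog p p' K) s (poly (q + q' + [:14:]) (size (s 0)))
        (\<lambda>s'. s' 0 = Node (f (s 0)) (g (s 0)) \<and> (\<forall>i>K + 2. s' i = s i))" for s
      using halts_within_pair_prog[OF p K(1) p' K(2)] by simp
    show "size (Node (f d) (g d)) \<le> poly (r + r' + 1) (size d)" for d
      using f[of d] g[of d] by simp
  qed
qed

abbreviation fptime2 :: "(data \<Rightarrow> data \<Rightarrow> data) \<Rightarrow> bool" where
  "fptime2 f \<equiv> fptime (\<lambda>e. f (fst_data e) (snd_data e))"

abbreviation fptime3 :: "(data \<Rightarrow> data \<Rightarrow> data \<Rightarrow> data) \<Rightarrow> bool" where
  "fptime3 f \<equiv> fptime2 (\<lambda>x e. f x (fst_data e) (snd_data e))"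

lemma fptime_comp2:
  assumes "fptime2 h" "fptime f" "fptime g"
  shows "fptime (\<lambda>d. h (f d) (g d))"
  using fptime_comp[OF fptime_Node[OF assms(2,3)] assms(1)] by simp

lemma fptime_if_neq_Nl:
  assumes "fptime c" "fptime f" "fptime g"
  shows "fptime (\<lambda>d. if c d \<noteq> Nl then f d else g d)"
proof -
  let ?select = "\<lambda>e. if fst_data e \<noteq> Nl then fst_data (snd_data e) else snd_data (snd_data e)"
  let ?p = "Cond (Fst_E (Var 0))
    (Asgn 0 (Fst_E (Snd_E (Var 0)))) (Asgn 0 (Snd_E (Snd_E (Var 0))))"
  have "fptime ?select"
  proof (rule fptimeI)
    show "halts_within ?p s (poly [:7:] (size (s 0)))
        (\<lambda>s'. s' 0 = ?select (s 0) \<and> (\<forall>i>0. s' i = s i))" for s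
      by (rule halts_within_Cond[where T = 4]) (auto intro: halts_within_Asgn)
    show "size (?select e) \<le> poly [:0, 1:] (size e)" for e
      by (auto intro: order_trans[OF size_fst_data_le size_snd_data_le]
          order_trans[OF size_snd_data_le size_snd_data_le])
  qed
  from fptime_comp[OF fptime_Node[OF assms(1) fptime_Node[OF assms(2,3)]] this] show ?thesis
    by (simp cong: if_cong)
qed

subsection \<open>Predicates\<close>

definition ptime :: "(data \<Rightarrow> bool) \<Rightarrow> bool" where
  "ptime P \<longleftrightarrow> fptime (\<lambda>d. enc_bool (P d))"

abbreviation ptime2 :: "(data \<Rightarrow> data \<Rightarrow> bool) \<Rightarrow> bool" where
  "ptime2 P \<equiv> ptime (\<lambda>e. P (fst_data e) (snd_data e))"

lemma enc_bool_eq_Nl_iff [simp]: "enc_bool b = Nl \<longleftrightarrow> \<not> b"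
  by (cases b) auto

lemma fptime_enc_bool: "ptime P \<Longrightarrow> fptime (\<lambda>d. enc_bool (P d))"
  by (simp add: ptime_def)

lemma fptime_if:
  assumes "ptime P" "fptime f" "fptime g"
  shows "fptime (\<lambda>d. if P d then f d else g d)"
  using fptime_if_neq_Nl[OF fptime_enc_bool[OF assms(1)] assms(2,3)] by simp

lemma ptime_if:
  assumes "ptime P" "ptime Q" "ptime R"
  shows "ptime (\<lambda>d. if P d then Q d else R d)"
  using fptime_if[OF assms(1) assms(2,3)[THEN fptime_enc_bool]]
  by (simp add: ptime_def if_distrib)

lemma ptime_False: "ptime (\<lambda>_. False)"
  using fptime_Nl by (simp add: ptime_def)

lemma ptime_True: "ptime (\<lambda>_. True)"
  using fptime_Node[OF fptime_Nl fptime_Nl] by (simp add: ptime_def)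

lemma ptime_eq_Nl:
  assumes "fptime f"
  shows "ptime (\<lambda>d. f d = Nl)"
proof -
  have "enc_bool (f d = Nl) = (if f d \<noteq> Nl then enc_bool False else enc_bool True)" for d
    by simp
  then show ?thesis
    using fptime_if_neq_Nl[OF assms ptime_False[THEN fptime_enc_bool]
        ptime_True[THEN fptime_enc_bool]]
    by (simp only: ptime_def)
qed

lemma ptime_not: "ptime P \<Longrightarrow> ptime (\<lambda>d. \<not> P d)"
  using ptime_if[OF _ ptime_False ptime_True, of P] by (simp add: if_bool_eq_conj)

lemma ptime_conj: "ptime P \<Longrightarrow> ptime Q \<Longrightarrow> ptime (\<lambda>d. P d \<and> Q d)"
  using ptime_if[OF _ _ ptime_False, of P Q] by (simp add: if_bool_eq_disj)

lemma ptime_disj: "ptime P \<Longrightarrow> ptime Q \<Longrightarrow> ptime (\<lambda>d. P d \<or> Q d)"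
  using ptime_if[OF _ ptime_True, of P Q] by (simp add: if_bool_eq_conj disj_imp)

lemma ptime_iff:
  assumes "ptime P" "ptime Q"
  shows "ptime (\<lambda>d. P d \<longleftrightarrow> Q d)"
proof -
  have "(P d \<longleftrightarrow> Q d) = (if P d then Q d else \<not> Q d)" for d by simp
  then show ?thesis using ptime_if[OF assms ptime_not[OF assms(2)]] by simp
qed

lemmas ptime_logic = ptime_eq_Nl ptime_not ptime_conj ptime_disj ptime_iff

section \<open>Lists as trees\<close>

fun list_of_data :: "data \<Rightarrow> data list" where
  "list_of_data Nl = []"
| "list_of_data (Node x xs) = x # list_of_data xs"

fun data_of_list :: "data list \<Rightarrow> data" where
  "data_of_list [] = Nl"
| "data_of_list (x # xs) = Node x (data_of_list xs)"

lemma data_of_list_of_data [simp]: "data_of_list (list_of_data d) = d"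
  by (induction d) auto

lemma list_of_data_of_list [simp]: "list_of_data (data_of_list xs) = xs"
  by (induction xs) auto

lemma data_of_list_eq_Nl_iff [simp]: "data_of_list xs = Nl \<longleftrightarrow> xs = []"
  by (cases xs) auto

lemma enc_list_conv_map: "enc_list f xs = data_of_list (map f xs)"
  by (induction xs) auto

lemma enc_nat_conv_replicate: "enc_nat n = data_of_list (replicate n Nl)"
  by (induction n) auto

lemma length_le_size_data_of_list: "length xs \<le> size (data_of_list xs)"
  by (induction xs) auto

lemma size_nth_less_data_of_list: "i < length xs \<Longrightarrow> size (xs ! i) < size (data_of_list xs)"
  by (induction xs arbitrary: i) (auto simp: nth_Cons less_SucI trans_less_add2 split: nat.split)

subsection \<open>Folds\<close>

definition fold_body :: "prog \<Rightarrow> nat \<Rightarrow> prog" where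
  "fold_body p K = Seq
     (call p (Pair_E (Fst_E (Var (K + 1))) (Pair_E (Var (K + 2)) (Var K))) (K + 2))
     (Asgn (K + 1) (Snd_E (Var (K + 1))))"

lemma halts_within_fold_body:
  assumes p: "computes p k q f" "k < K"
    and s: "s K = d" "s (K + 1) = data_of_list (x # xs)" "s (K + 2) = a"
    and size: "size (Node x (Node a d)) \<le> N"
  shows "halts_within (fold_body p K) s (poly q N + 12) (\<lambda>s'. s' K = d \<and>
    s' (K + 1) = data_of_list xs \<and> s' (K + 2) = f (Node x (Node a d)) \<and> (\<forall>i>K + 2. s' i = s i))"
proof -
  let ?updated = "\<lambda>s'. s' K = d \<and> s' (K + 1) = data_of_list (x # xs) \<and>
    s' (K + 2) = f (Node x (Node a d)) \<and> (\<forall>i>K + 2. s' i = s i)"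
  have "halts_within (call p (Pair_E (Fst_E (Var (K + 1))) (Pair_E (Var (K + 2)) (Var K))) (K + 2))
      s (poly q N + 9) ?updated"
    by (rule halts_within_call[OF p(1), where d = "Node x (Node a d)"])
      (use s \<open>k < K\<close> poly_nat_mono[OF size, of q] in auto)
  then show ?thesis
    unfolding fold_body_def
    by (rule halts_within_Seq[where U = 3]) (auto intro: halts_within_Asgn)
qed

lemma halts_within_fold_loop:
  assumes p: "computes p k q f" "k < K"
    and "s K = d" "s (K + 1) = data_of_list xs" "s (K + 2) = a"
    and "\<And>i. i < length xs \<Longrightarrow>
      size (Node (xs ! i) (Node (fold (\<lambda>x a. f (Node x (Node a d))) (take i xs) a) d)) \<le> N"
  shows "halts_within (Loop (Var (K + 1)) (fold_body p K)) s (length xs * (poly q N + 14) + 2)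
    (\<lambda>s'. s' (K + 2) = fold (\<lambda>x a. f (Node x (Node a d))) xs a \<and> (\<forall>i>K + 2. s' i = s i))"
  using assms(3-)
proof (induction xs arbitrary: s a)
  case Nil
  then show ?case by (intro halts_within_Loop_False) auto
next
  case (Cons x xs)
  let ?g = "\<lambda>x a. f (Node x (Node a d))"
  let ?stepped = "\<lambda>s'. s' K = d \<and> s' (K + 1) = data_of_list xs \<and> s' (K + 2) = ?g x a \<and>
    (\<forall>i>K + 2. s' i = s i)"
  have "size (Node x (Node a d)) \<le> N" using Cons.prems(4)[of 0] by simp
  then have body: "halts_within (fold_body p K) s (poly q N + 12) ?stepped"
    by (rule halts_within_fold_body[OF p Cons.prems(1-3)])
  have rest: "halts_within (Loop (Var (K + 1)) (fold_body p K)) s'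
      (length xs * (poly q N + 14) + 2)
      (\<lambda>s''. s'' (K + 2) = fold ?g (x # xs) a \<and> (\<forall>i>K + 2. s'' i = s i))" if "?stepped s'" for s'
  proof (rule halts_within_mono[OF Cons.IH])
    show "size (Node (xs ! i) (Node (fold ?g (take i xs) (?g x a)) d)) \<le> N"
      if "i < length xs" for i
      using Cons.prems(4)[of "Suc i"] that by simp
  qed (use that in simp_all)
  show ?case
    by (rule halts_within_Loop_True[OF _ body rest]) (use Cons.prems(2) in simp_all)
qed

definition fold_prog :: "prog \<Rightarrow> prog \<Rightarrow> prog \<Rightarrow> nat \<Rightarrow> prog" where
  "fold_prog p p' p'' K = Seq (Asgn K (Var 0)) (Seq (call p' (Var K) (K + 1))
     (Seq (call p'' (Var K) (K + 2))
     (Seq (Loop (Var (K + 1)) (fold_body p K)) (Asgn 0 (Var (K + 2))))))"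

lemma halts_within_fold_prog:
  assumes p: "computes p k q f" "k < K"
    and p': "computes p' k' q' (\<lambda>d. data_of_list (xs d))" "k' < K"
    and p'': "computes p'' k'' q'' a" "k'' < K"
    and size: "\<And>i. i < length (xs (s 0)) \<Longrightarrow> size (Node (xs (s 0) ! i)
      (Node (fold (\<lambda>x a. f (Node x (Node a (s 0)))) (take i (xs (s 0))) (a (s 0))) (s 0))) \<le> N"
  shows "halts_within (fold_prog p p' p'' K) s
    (poly q' (size (s 0)) + poly q'' (size (s 0)) + length (xs (s 0)) * (poly q N + 14) + 14)
    (\<lambda>s'. s' 0 = fold (\<lambda>x a. f (Node x (Node a (s 0)))) (xs (s 0)) (a (s 0)) \<and>
      (\<forall>i>K + 2. s' i = s i))"
proof -
  let ?d = "s 0" and ?saved = "s(K := eval_expr (Var 0) s)"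
  let ?fold = "fold (\<lambda>x a. f (Node x (Node a ?d))) (xs ?d) (a ?d)"
  let ?T = "length (xs ?d) * (poly q N + 14) + 2"
  let ?call_xs = "call p' (Var K) (K + 1)" and ?call_a = "call p'' (Var K) (K + 2)"
    and ?loop = "Loop (Var (K + 1)) (fold_body p K)" and ?result = "Asgn 0 (Var (K + 2))"
  let ?list = "\<lambda>s'. s' K = ?d \<and> s' (K + 1) = data_of_list (xs ?d) \<and> (\<forall>i>K + 2. s' i = s i)"
  let ?acc = "\<lambda>s'. ?list s' \<and> s' (K + 2) = a ?d"
  let ?folded = "\<lambda>s'. s' (K + 2) = ?fold \<and> (\<forall>i>K + 2. s' i = s i)"
  let ?returned = "\<lambda>s'. s' 0 = ?fold \<and> (\<forall>i>K + 2. s' i = s i)"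
  have list: "halts_within ?call_xs ?saved (poly q' (size ?d) + 4) ?list"
    by (rule halts_within_call[OF p'(1), where d = ?d]) (use p'(2) in auto)
  have acc: "halts_within ?call_a s' (poly q'' (size ?d) + 4) ?acc" if "?list s'" for s'
    by (rule halts_within_call[OF p''(1), where d = ?d]) (use that p''(2) in auto)
  have loop: "halts_within ?loop s' ?T ?folded" if "?acc s'" for s'
  proof (rule halts_within_mono[OF _ order_refl])
    show "halts_within ?loop s' ?T (\<lambda>s''. s'' (K + 2) = ?fold \<and> (\<forall>i>K + 2. s'' i = s' i))"
      by (rule halts_within_fold_loop[OF p _ _ _ size]) (use that in simp_all)
  qed (use that in simp)
  have result: "halts_within ?result s' 2 ?returned" if "?folded s'" for s'
    by (rule halts_within_Asgn) (use that in auto)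
  have "halts_within (Seq ?loop ?result) s' (?T + 2) ?returned" if "?acc s'" for s'
    using loop[OF that] result by (rule halts_within_Seq) simp_all
  then have "halts_within (Seq ?call_a (Seq ?loop ?result)) s'
      (poly q'' (size ?d) + ?T + 6) ?returned" if "?list s'" for s'
    by (rule halts_within_Seq[OF acc[OF that]]) simp_all
  with list have "halts_within (Seq ?call_xs (Seq ?call_a (Seq ?loop ?result))) ?saved
      (poly q' (size ?d) + poly q'' (size ?d) + ?T + 10) ?returned"
    by (rule halts_within_Seq) simp_all
  then show ?thesis
    unfolding fold_prog_def by (rule halts_within_Seq_Asgn) simp
qed

text \<open>
  The bound on the intermediate accumulators is indispensable: iterated doubling is a fold.
\<close>

lemma fptime_fold:
  fixes Q :: "nat poly"
  assumes "fptime3 G"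
    and "fptime (\<lambda>d. data_of_list (xs d))" "fptime a"
    and bound: "\<And>d i. i \<le> length (xs d) \<Longrightarrow>
      size (fold (\<lambda>x a. G x a d) (take i (xs d)) (a d)) \<le> poly Q (size d)"
  shows "fptime (\<lambda>d. fold (\<lambda>x a. G x a d) (xs d) (a d))"
proof -
  let ?f = "\<lambda>e. G (fst_data e) (fst_data (snd_data e)) (snd_data (snd_data e))"
  obtain p k q where p: "computes p k q ?f"
    by (rule fptime_computesE[OF assms(1)])
  obtain p' k' q' where p': "computes p' k' q' (\<lambda>d. data_of_list (xs d))"
    by (rule fptime_computesE[OF assms(2)])
  obtain p'' k'' q'' where p'': "computes p'' k'' q'' a"
    by (rule fptime_computesE[OF assms(3)])
  obtain r' :: "nat poly" where xs: "\<And>d. size (data_of_list (xs d)) \<le> poly r' (size d)"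
    using fptime_sizeE[OF assms(2)] by blast
  define K where "K = Suc (max k (max k' k''))"
  have K: "k < K" "k' < K" "k'' < K" by (auto simp: K_def)
  define N where "N = r' + Q + [:2, 1:]"
  define T where "T = q' + q'' + r' * (pcompose q N + [:14:]) + [:14:]"
  show ?thesis
  proof (rule fptimeI[where p = "fold_prog p p' p'' K" and k = "K + 2" and q = T and r = Q])
    show "size (fold (\<lambda>x a. G x a d) (xs d) (a d)) \<le> poly Q (size d)" for d
      using bound[of "length (xs d)" d] by simp
    fix s :: store
    let ?d = "s 0"
    have size: "size (Node (xs ?d ! i) (Node (fold (\<lambda>x a. ?f (Node x (Node a ?d)))
        (take i (xs ?d)) (a ?d)) ?d)) \<le> poly N (size ?d)" if i: "i < length (xs ?d)" for i
      using size_nth_less_data_of_list[OF i] xs[of ?d] bound[of i ?d] i by (simp add: N_def)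
    have "length (xs ?d) * (poly q (poly N (size ?d)) + 14)
        \<le> poly r' (size ?d) * (poly q (poly N (size ?d)) + 14)"
      using order_trans[OF length_le_size_data_of_list xs] by (rule mult_le_mono1)
    then show "halts_within (fold_prog p p' p'' K) s (poly T (size ?d))
        (\<lambda>s'. s' 0 = fold (\<lambda>x a. G x a ?d) (xs ?d) (a ?d) \<and> (\<forall>i>K + 2. s' i = s i))"
      by (intro halts_within_mono[OF
            halts_within_fold_prog[OF p K(1) p' K(2) p'' K(3), of s, OF size]])
        (simp_all add: T_def poly_pcompose)
  qed
qed

lemma size_fold_le:
  assumes "\<And>x a. x \<in> set xs \<Longrightarrow> size (g x a) \<le> size a + B"
  shows "size (fold g xs a) \<le> size a + length xs * B"
  using assms
proof (induction xs arbitrary: a)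
  case (Cons x xs)
  then have "size (fold g xs (g x a)) \<le> size (g x a) + length xs * B" by simp
  moreover have "size (g x a) \<le> size a + B" using Cons.prems by simp
  ultimately show ?case by simp
qed simp

lemma fptime_fold_additive:
  fixes Q :: "nat poly"
  assumes "fptime3 G"
    and "fptime (\<lambda>d. data_of_list (xs d))" "fptime a"
    and grow: "\<And>x a d. size (G x a d) \<le> size a + poly Q (size x + size d)"
  shows "fptime (\<lambda>d. fold (\<lambda>x a. G x a d) (xs d) (a d))"
proof -
  obtain r :: "nat poly" where r: "\<And>d. size (data_of_list (xs d)) \<le> poly r (size d)"
    using fptime_sizeE[OF assms(2)] by blast
  obtain r' :: "nat poly" where r': "\<And>d. size (a d) \<le> poly r' (size d)"
    using fptime_sizeE[OF assms(3)] by blast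
  show ?thesis
  proof (rule fptime_fold[OF assms(1-3), where Q = "r' + r * pcompose Q (r + [:0, 1:])"])
    fix d i assume i: "i \<le> length (xs d)"
    let ?B = "poly Q (poly r (size d) + size d)"
    have "size (G x a d) \<le> size a + ?B" if "x \<in> set (take i (xs d))" for x a
    proof -
      have "size x \<le> poly r (size d)"
        using that r[of d] size_nth_less_data_of_list[of _ "xs d"]
        by (fastforce dest!: in_set_takeD simp: in_set_conv_nth)
      then show ?thesis
        using grow[of x a d] poly_nat_mono[of "size x + size d" "poly r (size d) + size d" Q]
        by simp
    qed
    then have "size (fold (\<lambda>x a. G x a d) (take i (xs d)) (a d)) \<le> size (a d) + i * ?B"
      using size_fold_le[of "take i (xs d)" "\<lambda>x a. G x a d" ?B "a d"] i by simp
    also have "\<dots> \<le> poly r' (size d) + poly r (size d) * ?B"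
      using i order_trans[OF length_le_size_data_of_list r] r'
      by (intro add_mono mult_le_mono1) (auto intro: order_trans)
    finally show "size (fold (\<lambda>x a. G x a d) (take i (xs d)) (a d))
        \<le> poly (r' + r * pcompose Q (r + [:0, 1:])) (size d)"
      by (simp add: poly_pcompose)
  qed
qed

subsection \<open>List operations\<close>

text \<open>
  The second argument of the bodies \<open>g\<close> and \<open>P\<close> below is an environment; with the whole input as
  environment, list operations can be nested.
\<close>

lemma fptime_data_of_list_of_data: "fptime f \<Longrightarrow> fptime (\<lambda>d. data_of_list (list_of_data (f d)))"
  by simp

lemma fptime_Nil: "fptime (\<lambda>_. data_of_list [])"
  by (simp add: fptime_Nl)

lemma fptime_Cons:
  assumes "fptime f" "fptime (\<lambda>d. data_of_list (xs d))"
  shows "fptime (\<lambda>d. data_of_list (f d # xs d))"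
  using fptime_Node[OF assms] by simp

lemma fptime3_if_fptime2:
  assumes "fptime2 g"
  shows "fptime3 (\<lambda>x a d. g x d)"
  by (rule fptime_comp2[OF assms]) (intro fptime_fst_data fptime_snd_data fptime_id)+

lemma fold_Node_eq_rev_map_append:
  "fold (\<lambda>x a. Node (g x) a) xs (data_of_list ys) = data_of_list (rev (map g xs) @ ys)"
  by (induction xs arbitrary: ys) (simp_all flip: data_of_list.simps(2))

lemma fptime_rev_map_append:
  assumes "fptime2 g"
    and "fptime (\<lambda>d. data_of_list (xs d))" "fptime (\<lambda>d. data_of_list (ys d))"
  shows "fptime (\<lambda>d. data_of_list (rev (map (\<lambda>x. g x d) (xs d)) @ ys d))"
proof -
  obtain r :: "nat poly" where r: "\<And>e. size (g (fst_data e) (snd_data e)) \<le> poly r (size e)"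
    using fptime_sizeE[OF assms(1)] by blast
  have "fptime (\<lambda>d. fold (\<lambda>x a. Node (g x d) a) (xs d) (data_of_list (ys d)))"
  proof (rule fptime_fold_additive[OF _ assms(2,3), where Q = "pcompose r [:1, 1:] + 1"])
    show "fptime3 (\<lambda>x a d. Node (g x d) a)"
      by (intro fptime_Node fptime3_if_fptime2[OF assms(1)] fptime_fst_data fptime_snd_data
          fptime_id)
    show "size (Node (g x d) a) \<le> size a + poly (pcompose r [:1, 1:] + 1) (size x + size d)"
      for x a d
      using r[of "Node x d"] by (simp add: poly_pcompose)
  qed
  then show ?thesis by (simp add: fold_Node_eq_rev_map_append)
qed

lemma fptime_rev:
  assumes "fptime (\<lambda>d. data_of_list (xs d))"
  shows "fptime (\<lambda>d. data_of_list (rev (xs d)))"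
  using fptime_rev_map_append[OF fptime_fst_data[OF fptime_id] assms fptime_Nil] by simp

lemma fptime_map:
  assumes "fptime2 g" "fptime (\<lambda>d. data_of_list (xs d))"
  shows "fptime (\<lambda>d. data_of_list (map (\<lambda>x. g x d) (xs d)))"
  using fptime_rev_map_append[OF assms(1) fptime_rev[OF assms(2)] fptime_Nil]
  by (simp flip: rev_map)

lemma fptime_append:
  assumes "fptime (\<lambda>d. data_of_list (xs d))" "fptime (\<lambda>d. data_of_list (ys d))"
  shows "fptime (\<lambda>d. data_of_list (xs d @ ys d))"
  using fptime_rev_map_append[OF fptime_fst_data[OF fptime_id] fptime_rev[OF assms(1)] assms(2)]
  by simp

lemma fold_if_enc_bool_eq_bex:
  "fold (\<lambda>x a. if P x then enc_bool True else a) xs (enc_bool b)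
    = enc_bool (b \<or> (\<exists>x\<in>set xs. P x))"
proof (induction xs arbitrary: b)
  case (Cons x xs)
  show ?case using Cons.IH[of True] Cons.IH[of b] by (auto simp del: enc_bool.simps)
qed simp

lemma ptime_bex:
  assumes "ptime2 P" "fptime (\<lambda>d. data_of_list (xs d))"
  shows "ptime (\<lambda>d. \<exists>x\<in>set (xs d). P x d)"
proof -
  have "fptime3 (\<lambda>x a d. enc_bool (P x d))"
    by (rule fptime3_if_fptime2[OF fptime_enc_bool[OF assms(1)]])
  then have "fptime3 (\<lambda>x a d. if P x d then enc_bool True else a)"
    by (intro fptime_if ptime_True[THEN fptime_enc_bool] fptime_fst_data fptime_snd_data fptime_id)
      (simp add: ptime_def)
  then have "fptime (\<lambda>d. fold (\<lambda>x a. if P x d then enc_bool True else a) (xs d) (enc_bool False))"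
    by (rule fptime_fold_additive[OF _ assms(2) ptime_False[THEN fptime_enc_bool], where Q = 1])
      auto
  then show ?thesis
    unfolding fold_if_enc_bool_eq_bex by (simp add: ptime_def)
qed

lemma fold_snd_data_eq_drop:
  "fold (\<lambda>_. snd_data) xs (data_of_list ys) = data_of_list (drop (length xs) ys)"
proof (induction xs arbitrary: ys)
  case (Cons x xs)
  have "snd_data (data_of_list ys) = data_of_list (tl ys)" by (cases ys) auto
  then show ?case by (simp add: Cons.IH drop_Suc)
qed simp

lemma ptime_length_le:
  assumes "fptime (\<lambda>d. data_of_list (xs d))" "fptime (\<lambda>d. data_of_list (ys d))"
  shows "ptime (\<lambda>d. length (xs d) \<le> length (ys d))"
proof -
  have "fptime (\<lambda>d. fold (\<lambda>_. snd_data) (ys d) (data_of_list (xs d)))"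
  proof (rule fptime_fold_additive[OF _ assms(2,1), where Q = 0])
    show "fptime3 (\<lambda>x a d. snd_data a)"
      by (intro fptime_fst_data fptime_snd_data fptime_id)
  qed (simp add: size_snd_data_le)
  then have "ptime (\<lambda>d. data_of_list (drop (length (ys d)) (xs d)) = Nl)"
    unfolding fold_snd_data_eq_drop by (rule ptime_eq_Nl)
  then show ?thesis by simp
qed

lemma ptime_length_eq:
  assumes "fptime (\<lambda>d. data_of_list (xs d))" "fptime (\<lambda>d. data_of_list (ys d))"
  shows "ptime (\<lambda>d. length (xs d) = length (ys d))"
  unfolding eq_iff by (intro ptime_conj ptime_length_le assms)

lemma fold_succ_eq_rev_upt:
  "fold (\<lambda>_ a. Node (if a \<noteq> Nl then Node Nl (fst_data a) else Nl) a) xs Nl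
    = data_of_list (map enc_nat (rev [0..<length xs]))"
proof (induction xs rule: rev_induct)
  case (snoc x xs)
  then show ?case by (cases "length xs") auto
qed simp

lemma size_enc_nat [simp]: "size (enc_nat n) = n"
  by (induction n) auto

lemma size_data_of_list_upt_le: "size (data_of_list (map enc_nat (rev [0..<n]))) \<le> n * (n + 1)"
  by (induction n) auto

lemma fptime_upt:
  assumes "fptime (\<lambda>d. data_of_list (xs d))"
  shows "fptime (\<lambda>d. data_of_list (map enc_nat [0..<length (xs d)]))"
proof -
  obtain r :: "nat poly" where r: "\<And>d. size (data_of_list (xs d)) \<le> poly r (size d)"
    using fptime_sizeE[OF assms] by blast
  let ?step = "\<lambda>_ a. Node (if a \<noteq> Nl then Node Nl (fst_data a) else Nl) a"
  have "fptime (\<lambda>d. fold ?step (xs d) Nl)"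
  proof (rule fptime_fold[OF _ assms fptime_Nl, where Q = "r * (r + 1)"])
    show "fptime3 (\<lambda>x a d. ?step x a)"
      by (intro fptime_Node fptime_if_neq_Nl fptime_Nl fptime_fst_data fptime_snd_data fptime_id)
    fix d i assume i: "i \<le> length (xs d)"
    have "i \<le> poly r (size d)"
      using i length_le_size_data_of_list[of "xs d"] r[of d] by linarith
    then have "i * (i + 1) \<le> poly (r * (r + 1)) (size d)"
      by (simp add: mult_le_mono del: mult_Suc_right)
    then show "size (fold ?step (take i (xs d)) Nl) \<le> poly (r * (r + 1)) (size d)"
      unfolding fold_succ_eq_rev_upt
      using size_data_of_list_upt_le[of i] i by (simp add: min_def)
  qed
  from fptime_rev[OF this[unfolded fold_succ_eq_rev_upt]] show ?thesis
    by (simp flip: rev_map)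
qed

section \<open>Parameterized reductions\<close>

primrec clear_vars :: "nat \<Rightarrow> prog" where
  "clear_vars 0 = Asgn 0 (Var 0)"
| "clear_vars (Suc k) = Seq (clear_vars k) (Asgn (Suc k) Nil_E)"

lemma exec_clear_vars:
  "exec (clear_vars k) s (2 * k + 2) (\<lambda>i. if 0 < i \<and> i \<le> k then Nl else s i)"
proof (induction k)
  case 0
  have "(\<lambda>i. if 0 < i \<and> i \<le> 0 then Nl else s i) = s(0 := eval_expr (Var 0) s)" by auto
  then show ?case using exec.Asgn[of 0 "Var 0" s] by simp
next
  case (Suc k)
  let ?s = "\<lambda>i. if 0 < i \<and> i \<le> k then Nl else s i"
  have "(\<lambda>i. if 0 < i \<and> i \<le> Suc k then Nl else s i) = ?s(Suc k := eval_expr Nil_E ?s)"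
    by (auto simp: fun_eq_iff)
  then show ?case using exec.Seq[OF Suc exec.Asgn[of "Suc k" Nil_E ?s]] by simp
qed

definition ptime_reduction ::
    "'i set \<Rightarrow> ('i \<Rightarrow> bool) \<Rightarrow> ('i \<Rightarrow> data) \<Rightarrow> 'j set \<Rightarrow> ('j \<Rightarrow> bool) \<Rightarrow> ('j \<Rightarrow> data) \<Rightarrow> ('i \<Rightarrow> 'j) \<Rightarrow> bool"
where
  "ptime_reduction X Q encX Y R encY f \<longleftrightarrow> (\<exists>F. fptime F \<and>
     (\<forall>x\<in>X. f x \<in> Y \<and> encY (f x) = F (encX x) \<and> (R (f x) \<longleftrightarrow> Q x)))"

lemma solvable_within_ptime_reduction:
  assumes "ptime_reduction X Q encX Y R encY f" "solvable_within Y R encY T"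
  obtains q :: "nat poly" where
    "solvable_within X Q encX (\<lambda>x. real (poly q (size (encX x))) + T (f x))"
proof -
  obtain F where "fptime F"
      and red: "\<And>x. x \<in> X \<Longrightarrow> f x \<in> Y" "\<And>x. x \<in> X \<Longrightarrow> encY (f x) = F (encX x)"
        "\<And>x. x \<in> X \<Longrightarrow> R (f x) \<longleftrightarrow> Q x"
    using assms(1) unfolding ptime_reduction_def by blast
  obtain p k q where p: "computes p k q F" by (rule fptime_computesE[OF \<open>fptime F\<close>])
  obtain p' where p': "\<And>y. y \<in> Y \<Longrightarrow>
      \<exists>t s. exec p' (init_store (encY y)) t s \<and> (s 0 \<noteq> Nl \<longleftrightarrow> R y) \<and> real t \<le> T y"
    using assms(2) unfolding solvable_within_def by blast
  have "\<exists>t s. exec (Seq p (Seq (clear_vars k) p')) (init_store (encX x)) t s \<and> (s 0 \<noteq> Nl \<longleftrightarrow> Q x)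
      \<and> real t \<le> real (poly (q + [:2 * k + 2:]) (size (encX x))) + T (f x)" if x: "x \<in> X" for x
  proof -
    let ?s = "init_store (encX x)"
    obtain t s where run: "exec p ?s t s" "t \<le> poly q (size (encX x))"
        and s: "s 0 = F (encX x)" "\<forall>i>k. s i = ?s i"
      using p[unfolded computes_def halts_within_def, THEN spec[of _ ?s]]
      by (auto simp: init_store_def)
    have "(\<lambda>i. if 0 < i \<and> i \<le> k then Nl else s i) = init_store (encY (f x))"
      using s red(2)[OF x] by (auto simp: fun_eq_iff init_store_def)
    then have clear: "exec (clear_vars k) s (2 * k + 2) (init_store (encY (f x)))"
      using exec_clear_vars[of k s] by simp
    obtain t' s' where solve: "exec p' (init_store (encY (f x))) t' s'" "s' 0 \<noteq> Nl \<longleftrightarrow> R (f x)"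
      "real t' \<le> T (f x)" using p'[OF red(1)[OF x]] by blast
    have "real (t + (2 * k + 2 + t')) \<le> real (poly (q + [:2 * k + 2:]) (size (encX x))) + T (f x)"
      using run(2) solve(3) by simp
    with exec.Seq[OF run(1) exec.Seq[OF clear solve(1)]] solve(2) red(3)[OF x] show ?thesis
      by blast
  qed
  then show ?thesis using that unfolding solvable_within_def by blast
qed

lemma solvable_within_mono:
  assumes "solvable_within X Q enc T" "\<And>x. x \<in> X \<Longrightarrow> T x \<le> T' x"
  shows "solvable_within X Q enc T'"
  using assms unfolding solvable_within_def by (meson order_trans)

lemma solvable_within_imp_pos:
  assumes "solvable_within X Q enc T" "x \<in> X"
  shows "0 < T x"
  using assms exec_time_pos unfolding solvable_within_def
  by (meson less_le_trans of_nat_0_less_iff)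

definition solvable_with_base ::
    "'i set \<Rightarrow> ('i \<Rightarrow> bool) \<Rightarrow> ('i \<Rightarrow> data) \<Rightarrow> ('i \<Rightarrow> nat) \<Rightarrow> ('i \<Rightarrow> nat) \<Rightarrow> real \<Rightarrow> bool" where
  "solvable_with_base X Q enc param sz b \<longleftrightarrow>
     (\<exists>q :: nat poly. solvable_within X Q enc (\<lambda>x. b ^ param x * real (poly q (sz x))))"

lemma solvable_with_base_imp_pos:
  assumes "solvable_with_base X Q enc param sz b" "x \<in> X" "odd (param x)"
  shows "0 < b"
proof -
  obtain q :: "nat poly" where "solvable_within X Q enc (\<lambda>x. b ^ param x * real (poly q (sz x)))"
    using assms(1) unfolding solvable_with_base_def by (elim exE)
  from solvable_within_imp_pos[OF this assms(2)] have "0 < b ^ param x"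
    by (simp add: zero_less_mult_iff)
  with assms(3) show ?thesis by (auto simp: zero_less_power_eq)
qed

lemma solvable_with_base_mono:
  assumes "solvable_with_base X Q enc param sz b" "0 \<le> b" "b \<le> b'"
  shows "solvable_with_base X Q enc param sz b'"
proof -
  obtain q :: "nat poly" where "solvable_within X Q enc (\<lambda>x. b ^ param x * real (poly q (sz x)))"
    using assms(1) unfolding solvable_with_base_def by (elim exE)
  then have "solvable_within X Q enc (\<lambda>x. b' ^ param x * real (poly q (sz x)))"
    by (rule solvable_within_mono) (intro mult_right_mono power_mono assms(2,3) of_nat_0_le_iff)
  then show ?thesis unfolding solvable_with_base_def by (rule exI)
qed

lemma solvable_with_base_ptime_reduction:
  fixes q\<^sub>1 q\<^sub>2 :: "nat poly"
  assumes red: "ptime_reduction X Q encX Y R encY f"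
    and param: "\<And>x. x \<in> X \<Longrightarrow> param' (f x) \<le> param x"
    and input_size: "\<And>x. x \<in> X \<Longrightarrow> size (encX x) \<le> poly q\<^sub>1 (sz x)"
    and output_size: "\<And>x. x \<in> X \<Longrightarrow> sz' (f x) \<le> poly q\<^sub>2 (sz x)"
    and "1 \<le> b" "solvable_with_base Y R encY param' sz' b"
  shows "solvable_with_base X Q encX param sz b"
proof -
  obtain q :: "nat poly" where
      "solvable_within Y R encY (\<lambda>y. b ^ param' y * real (poly q (sz' y)))"
    using assms(6) unfolding solvable_with_base_def by (elim exE)
  from solvable_within_ptime_reduction[OF red this] obtain q' :: "nat poly" where q':
    "solvable_within X Q encX
      (\<lambda>x. real (poly q' (size (encX x))) + b ^ param' (f x) * real (poly q (sz' (f x))))" .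
  have "real (poly q' (size (encX x))) + b ^ param' (f x) * real (poly q (sz' (f x)))
      \<le> b ^ param x * real (poly (pcompose q' q\<^sub>1 + pcompose q q\<^sub>2) (sz x))" if x: "x \<in> X" for x
  proof -
    have "real (poly q' (size (encX x))) \<le> real (poly q' (poly q\<^sub>1 (sz x)))"
      using poly_nat_mono[OF input_size[OF x]] by simp
    also have "\<dots> \<le> b ^ param x * real (poly q' (poly q\<^sub>1 (sz x)))"
      using one_le_power[OF \<open>1 \<le> b\<close>] by (simp add: mult_le_cancel_right1)
    finally have "real (poly q' (size (encX x)))
        \<le> b ^ param x * real (poly q' (poly q\<^sub>1 (sz x)))" .
    moreover have "b ^ param' (f x) * real (poly q (sz' (f x)))
        \<le> b ^ param x * real (poly q (poly q\<^sub>2 (sz x)))"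
      using poly_nat_mono[OF output_size[OF x]] power_increasing[OF param[OF x] \<open>1 \<le> b\<close>] \<open>1 \<le> b\<close>
      by (intro mult_mono) auto
    ultimately show ?thesis by (simp add: poly_pcompose distrib_left)
  qed
  from solvable_within_mono[OF q' this] show ?thesis
    unfolding solvable_with_base_def by (intro exI)
qed

section \<open>From CNF-SAT to Colorful Graph Motif\<close>

subsection \<open>The reduction\<close>

datatype vertex = Literal literal | Clause "literal list" | Root

fun adjacent :: "vertex \<Rightarrow> vertex \<Rightarrow> bool" where
  "adjacent (Literal l) (Clause C) \<longleftrightarrow> l \<in> set C"
| "adjacent (Clause C) (Literal l) \<longleftrightarrow> l \<in> set C"
| "adjacent (Literal l) Root \<longleftrightarrow> True"
| "adjacent Root (Literal l) \<longleftrightarrow> True"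
| "adjacent u v \<longleftrightarrow> False"

definition cnf_vertices :: "cnf \<Rightarrow> vertex list" where
  "cnf_vertices \<Phi> = map (\<lambda>x. Literal (x, True)) [0..<num_vars \<Phi>]
     @ map (\<lambda>x. Literal (x, False)) [0..<num_vars \<Phi>] @ map Clause \<Phi> @ [Root]"

text \<open>
  The vertices of the instance are the positions in \<^const>\<open>cnf_vertices\<close>. The coloring identifies
  the positions \<open>x\<close> and \<open>num_vars \<Phi> + x\<close> of the two literals of a variable \<open>x\<close>.
\<close>

definition cnf_to_cgm :: "cnf \<Rightarrow> cgm" where
  "cnf_to_cgm \<Phi> = (let V = cnf_vertices \<Phi>; r = num_vars \<Phi> in
     \<lparr> cgm_motif = {..<r + length \<Phi> + 1},
       cgm_graph = \<lparr> pverts = {..<length V},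
         parcs = {(u, v). u < length V \<and> v < length V \<and> adjacent (V ! u) (V ! v)} \<rparr>,
       cgm_coloring = (\<lambda>v. if v < r then v else v - r) \<rparr>)"

lemma length_cnf_vertices: "length (cnf_vertices \<Phi>) = 2 * num_vars \<Phi> + length \<Phi> + 1"
  by (simp add: cnf_vertices_def)

lemma cgm_verts_cnf_to_cgm: "cgm_verts (cnf_to_cgm \<Phi>) = {..<length (cnf_vertices \<Phi>)}"
  by (simp add: cnf_to_cgm_def cgm_verts_def Let_def)

lemma cgm_motif_cnf_to_cgm: "cgm_motif (cnf_to_cgm \<Phi>) = {..<num_vars \<Phi> + length \<Phi> + 1}"
  by (simp add: cnf_to_cgm_def Let_def)

lemma cgm_coloring_cnf_to_cgm:
  "cgm_coloring (cnf_to_cgm \<Phi>) v = (if v < num_vars \<Phi> then v else v - num_vars \<Phi>)"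
  by (simp add: cnf_to_cgm_def Let_def)

lemma parcs_cnf_to_cgm:
  "(u, v) \<in> parcs (cgm_graph (cnf_to_cgm \<Phi>)) \<longleftrightarrow> u < length (cnf_vertices \<Phi>) \<and>
     v < length (cnf_vertices \<Phi>) \<and> adjacent (cnf_vertices \<Phi> ! u) (cnf_vertices \<Phi> ! v)"
  by (simp add: cnf_to_cgm_def Let_def)

lemma cgm_colors_cnf_to_cgm: "cgm_colors (cnf_to_cgm \<Phi>) = {..<num_vars \<Phi> + length \<Phi> + 1}"
  by (auto simp: cgm_colors_def cgm_verts_cnf_to_cgm cgm_motif_cnf_to_cgm cgm_coloring_cnf_to_cgm
      length_cnf_vertices)

lemma cgm_param_cnf_to_cgm: "cgm_param (cnf_to_cgm \<Phi>) = num_vars \<Phi>"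
  by (simp add: cgm_param_def cgm_verts_cnf_to_cgm cgm_motif_cnf_to_cgm length_cnf_vertices)

lemma adjacent_commute: "adjacent u v \<longleftrightarrow> adjacent v u"
  by (cases u; cases v) auto

lemma not_adjacent_self: "\<not> adjacent u u"
  by (cases u) auto

lemma pair_graph_cnf_to_cgm: "pair_graph (cgm_graph (cnf_to_cgm \<Phi>))" (is "pair_graph ?G")
proof
  have verts: "pverts ?G = {..<length (cnf_vertices \<Phi>)}"
    using cgm_verts_cnf_to_cgm[of \<Phi>] by (simp add: cgm_verts_def)
  have arcs: "parcs ?G \<subseteq> pverts ?G \<times> pverts ?G"
    by (auto simp: verts parcs_cnf_to_cgm)
  show "fst e \<in> pverts ?G" "snd e \<in> pverts ?G" if "e \<in> parcs ?G" for e
    using arcs that by auto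
  show "finite (pverts ?G)" by (simp add: verts)
  with arcs show "finite (parcs ?G)" by (simp add: finite_subset)
  show "symmetric ?G"
    by (auto simp: symmetric_def sym_def parcs_cnf_to_cgm adjacent_commute)
  show "fst e \<noteq> snd e" if "e \<in> parcs ?G" for e
    using that by (cases e) (auto simp: parcs_cnf_to_cgm not_adjacent_self)
qed

lemma cnf_to_cgm_in_cgm_instances: "cnf_to_cgm \<Phi> \<in> cgm_instances"
  by (simp add: cgm_instances_def pair_graph_cnf_to_cgm cgm_verts_cnf_to_cgm cgm_motif_cnf_to_cgm
      cgm_colors_cnf_to_cgm length_cnf_vertices)

subsection \<open>Correctness\<close>

lemma connected_induce_subgraph_iff:
  assumes "pair_graph G"
  shows "Digraph_Component.connected (with_proj G \<restriction> S) \<longleftrightarrow>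
    S \<noteq> {} \<and> (\<forall>u\<in>S. \<forall>v\<in>S. (u, v) \<in> (parcs G \<inter> S \<times> S)\<^sup>*)"
proof -
  interpret pair_graph G by (fact assms)
  let ?E = "parcs G \<inter> S \<times> S"
  have "parcs (mk_symmetric (with_proj G \<restriction> S)) = ?E"
    using sym_arcs by (auto simp: parcs_mk_symmetric symmetric_def sym_def induce_subgraph_def)
  moreover have "(u, v) \<in> rtrancl_on S ?E \<longleftrightarrow> (u, v) \<in> ?E\<^sup>*" if "u \<in> S" "v \<in> S" for u v
  proof
    show "(u, v) \<in> rtrancl_on S ?E" if "(u, v) \<in> ?E\<^sup>*"
      using that \<open>u \<in> S\<close> \<open>v \<in> S\<close> by (rule rtrancl_consistent_rtrancl_on) auto
  qed (rule rtrancl_on_rtranclI)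
  ultimately show ?thesis
    by (simp add: Digraph_Component.connected_def strongly_connected_def reachable_def)
qed

definition cgm_solution :: "cgm \<Rightarrow> nat set \<Rightarrow> bool" where
  "cgm_solution I S \<longleftrightarrow> S \<subseteq> cgm_verts I \<and> S \<noteq> {} \<and>
     (\<forall>u\<in>S. \<forall>v\<in>S. (u, v) \<in> (parcs (cgm_graph I) \<inter> S \<times> S)\<^sup>*) \<and>
     bij_betw (cgm_coloring I) S (cgm_motif I)"

lemma cgm_solvable_iff_cgm_solution:
  assumes "pair_graph (cgm_graph I)"
  shows "cgm_solvable I \<longleftrightarrow> (\<exists>S. cgm_solution I S)"
proof -
  have "(\<exists>f. bij_betw f S (cgm_motif I) \<and> (\<forall>v\<in>S. f v = cgm_coloring I v)) \<longleftrightarrow>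
      bij_betw (cgm_coloring I) S (cgm_motif I)" for S
  proof
    assume "\<exists>f. bij_betw f S (cgm_motif I) \<and> (\<forall>v\<in>S. f v = cgm_coloring I v)"
    then obtain f where "bij_betw f S (cgm_motif I)" "\<And>v. v \<in> S \<Longrightarrow> f v = cgm_coloring I v" by blast
    then show "bij_betw (cgm_coloring I) S (cgm_motif I)" using bij_betw_cong by metis
  qed blast
  with assms show ?thesis
    by (simp only: cgm_solvable_def cgm_solution_def connected_induce_subgraph_iff conj_assoc)
qed

definition literal_position :: "cnf \<Rightarrow> literal \<Rightarrow> nat" where
  "literal_position \<Phi> l = (if snd l then fst l else num_vars \<Phi> + fst l)"

lemma nth_cnf_vertices_literal:
  "x < num_vars \<Phi> \<Longrightarrow> cnf_vertices \<Phi> ! literal_position \<Phi> (x, b) = Literal (x, b)"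
  by (simp add: cnf_vertices_def literal_position_def nth_append)

lemma nth_cnf_vertices_clause:
  "j < length \<Phi> \<Longrightarrow> cnf_vertices \<Phi> ! (2 * num_vars \<Phi> + j) = Clause (\<Phi> ! j)"
  by (simp add: cnf_vertices_def nth_append)

lemma nth_cnf_vertices_root: "cnf_vertices \<Phi> ! (2 * num_vars \<Phi> + length \<Phi>) = Root"
  by (simp add: cnf_vertices_def nth_append)

lemma nth_cnf_vertices_eq_LiteralD:
  assumes "cnf_vertices \<Phi> ! v = Literal (x, b)" "v < length (cnf_vertices \<Phi>)"
  shows "x < num_vars \<Phi>" "v = literal_position \<Phi> (x, b)"
  using assms
  by (auto simp: cnf_vertices_def literal_position_def nth_append nth_Cons' split: if_splits)

lemma clause_or_root_in_cgm_solution: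
  assumes "cgm_solution (cnf_to_cgm \<Phi>) S" "j \<le> length \<Phi>"
  shows "2 * num_vars \<Phi> + j \<in> S"
proof -
  have "num_vars \<Phi> + j \<in> cgm_coloring (cnf_to_cgm \<Phi>) ` S"
    using assms by (simp add: cgm_solution_def bij_betw_def cgm_motif_cnf_to_cgm)
  then obtain v where "v \<in> S" "num_vars \<Phi> + j = cgm_coloring (cnf_to_cgm \<Phi>) v" by blast
  moreover from this have "v = 2 * num_vars \<Phi> + j"
    by (simp add: cgm_coloring_cnf_to_cgm split: if_splits)
  ultimately show ?thesis by simp
qed

lemma literal_position_in_cgm_solutionD:
  assumes S: "cgm_solution (cnf_to_cgm \<Phi>) S" and "x < num_vars \<Phi>" "literal_position \<Phi> (x, b) \<in> S"
  shows "(x \<in> S) = b"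
proof (cases b)
  case True
  then show ?thesis using assms(3) by (simp add: literal_position_def)
next
  case False
  let ?v = "num_vars \<Phi> + x"
  have "?v \<in> S" using assms(3) False by (simp add: literal_position_def)
  moreover have "cgm_coloring (cnf_to_cgm \<Phi>) ?v = cgm_coloring (cnf_to_cgm \<Phi>) x"
    using assms(2) by (simp add: cgm_coloring_cnf_to_cgm)
  moreover have "inj_on (cgm_coloring (cnf_to_cgm \<Phi>)) S"
    using S by (simp add: cgm_solution_def bij_betw_def)
  ultimately have "x \<notin> S" using inj_onD[of _ S ?v x] assms(2) by auto
  with False show ?thesis by simp
qed

lemma cgm_solution_satisfies_clause:
  assumes S: "cgm_solution (cnf_to_cgm \<Phi>) S" and C: "C \<in> set \<Phi>"
  shows "\<exists>(x, b)\<in>set C. (x \<in> S) = b"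
proof -
  let ?I = "cnf_to_cgm \<Phi>" and ?r = "num_vars \<Phi>" and ?m = "length \<Phi>"
  obtain j where j: "j < ?m" "C = \<Phi> ! j" using C by (auto simp: in_set_conv_nth)
  have "(2 * ?r + j, 2 * ?r + ?m) \<in> (parcs (cgm_graph ?I) \<inter> S \<times> S)\<^sup>*"
    using j(1) S clause_or_root_in_cgm_solution[OF S] by (simp add: cgm_solution_def)
  then obtain u where u: "u \<in> S" "(2 * ?r + j, u) \<in> parcs (cgm_graph ?I)"
    using j(1) by (cases rule: converse_rtranclE) auto
  then have "adjacent (Clause C) (cnf_vertices \<Phi> ! u)" and "u < length (cnf_vertices \<Phi>)"
    using j by (simp_all add: parcs_cnf_to_cgm nth_cnf_vertices_clause)
  moreover from this obtain x b where l: "(x, b) \<in> set C" "cnf_vertices \<Phi> ! u = Literal (x, b)"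
    by (cases "cnf_vertices \<Phi> ! u") auto
  ultimately have "x < ?r" "literal_position \<Phi> (x, b) \<in> S"
    using nth_cnf_vertices_eq_LiteralD[OF l(2)] u(1) by simp_all
  then have "(x \<in> S) = b" by (rule literal_position_in_cgm_solutionD[OF S])
  with l(1) show ?thesis by (intro bexI[of _ "(x, b)"]) simp_all
qed

text \<open>The position of the vertex of color \<open>c\<close> in the solution for the assignment \<open>\<alpha>\<close>.\<close>

definition chosen_position :: "cnf \<Rightarrow> (nat \<Rightarrow> bool) \<Rightarrow> nat \<Rightarrow> nat" where
  "chosen_position \<Phi> \<alpha> c =
     (if c < num_vars \<Phi> then literal_position \<Phi> (c, \<alpha> c) else num_vars \<Phi> + c)"

lemma chosen_position_in_cgm_verts:
  "c < num_vars \<Phi> + length \<Phi> + 1 \<Longrightarrow> chosen_position \<Phi> \<alpha> c < length (cnf_vertices \<Phi>)"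
  by (auto simp: chosen_position_def literal_position_def length_cnf_vertices)

lemma cgm_coloring_chosen_position: "cgm_coloring (cnf_to_cgm \<Phi>) (chosen_position \<Phi> \<alpha> c) = c"
  by (auto simp: chosen_position_def literal_position_def cgm_coloring_cnf_to_cgm)

lemma var_less_num_vars:
  assumes "\<Phi> \<in> cnf_instances" "C \<in> set \<Phi>" "(x, b) \<in> set C"
  shows "x < num_vars \<Phi>"
  using assms by (force simp: cnf_instances_def cnf_vars_def)

lemma chosen_position_reaches_root:
  assumes \<Phi>: "\<Phi> \<in> cnf_instances" and \<alpha>: "\<forall>C\<in>set \<Phi>. \<exists>(x, b)\<in>set C. \<alpha> x = b"
    and S: "S = chosen_position \<Phi> \<alpha> ` {..<num_vars \<Phi> + length \<Phi> + 1}" and "v \<in> S"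
  shows "(v, 2 * num_vars \<Phi> + length \<Phi>) \<in> (parcs (cgm_graph (cnf_to_cgm \<Phi>)) \<inter> S \<times> S)\<^sup>*"
proof -
  let ?r = "num_vars \<Phi>" and ?m = "length \<Phi>" and ?w = "chosen_position \<Phi> \<alpha>"
    and ?V = "cnf_vertices \<Phi>" and ?E = "parcs (cgm_graph (cnf_to_cgm \<Phi>)) \<inter> S \<times> S"
  have arc: "(?w c, ?w c') \<in> ?E" if "adjacent (?V ! ?w c) (?V ! ?w c')"
      "c \<le> ?r + ?m" "c' \<le> ?r + ?m" for c c'
    using that chosen_position_in_cgm_verts[of _ \<Phi> \<alpha>] by (auto simp: S parcs_cnf_to_cgm)
  have chosen_root: "?w (?r + ?m) = 2 * ?r + ?m" by (simp add: chosen_position_def)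
  have chosen_literal: "?V ! ?w x = Literal (x, \<alpha> x)" if "x < ?r" for x
    using that by (simp add: chosen_position_def nth_cnf_vertices_literal)
  have to_root: "(?w x, 2 * ?r + ?m) \<in> ?E" if "x < ?r" for x
    using arc[of x "?r + ?m"] that by (simp add: chosen_root chosen_literal nth_cnf_vertices_root)
  obtain c where c: "v = ?w c" "c \<le> ?r + ?m" using \<open>v \<in> S\<close> by (auto simp: S)
  then consider (literal) "c < ?r" | (clause) "?r \<le> c" "c < ?r + ?m" | (root) "c = ?r + ?m"
    by linarith
  then show ?thesis
  proof cases
    case literal
    then show ?thesis using c(1) to_root by blast
  next
    case clause
    then obtain j where j: "c = ?r + j" "j < ?m" by (auto simp: le_iff_add)
    then have chosen_clause: "?V ! ?w c = Clause (\<Phi> ! j)"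
      using nth_cnf_vertices_clause[of j \<Phi>] by (simp add: chosen_position_def mult_2 add.assoc)
    obtain x where x: "(x, \<alpha> x) \<in> set (\<Phi> ! j)" using \<alpha> nth_mem[OF j(2)] by fastforce
    have "x < ?r" using var_less_num_vars[OF \<Phi> nth_mem[OF j(2)] x] .
    then have "(v, ?w x) \<in> ?E"
      using arc[of c x] c x by (simp add: chosen_clause chosen_literal)
    with to_root[OF \<open>x < ?r\<close>] show ?thesis
      by (meson converse_rtrancl_into_rtrancl r_into_rtrancl)
  next
    case root
    then show ?thesis using c(1) by (simp add: chosen_root)
  qed
qed

lemma rtrancl_if_common_successor:
  assumes "sym r" "(u, w) \<in> r\<^sup>*" "(v, w) \<in> r\<^sup>*"
  shows "(u, v) \<in> r\<^sup>*"
  using assms by (meson rtrancl_trans symD sym_rtrancl)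

lemma cgm_solution_chosen_positions:
  assumes "\<Phi> \<in> cnf_instances" "\<forall>C\<in>set \<Phi>. \<exists>(x, b)\<in>set C. \<alpha> x = b"
  shows "cgm_solution (cnf_to_cgm \<Phi>) (chosen_position \<Phi> \<alpha> ` {..<num_vars \<Phi> + length \<Phi> + 1})"
    (is "cgm_solution ?I ?S")
  unfolding cgm_solution_def
proof (intro conjI ballI)
  show "?S \<subseteq> cgm_verts ?I"
    using chosen_position_in_cgm_verts by (auto simp: cgm_verts_cnf_to_cgm)
  show "?S \<noteq> {}" by (simp add: lessThan_empty_iff)
  show "bij_betw (cgm_coloring ?I) ?S (cgm_motif ?I)"
    unfolding cgm_motif_cnf_to_cgm
    by (rule bij_betwI[where g = "chosen_position \<Phi> \<alpha>"]) (auto simp: cgm_coloring_chosen_position)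
  have "sym (parcs (cgm_graph ?I) \<inter> ?S \<times> ?S)"
    by (auto simp: sym_def parcs_cnf_to_cgm adjacent_commute)
  then show "(u, v) \<in> (parcs (cgm_graph ?I) \<inter> ?S \<times> ?S)\<^sup>*" if "u \<in> ?S" "v \<in> ?S" for u v
    by (rule rtrancl_if_common_successor)
      (rule chosen_position_reaches_root[OF assms refl that(1)],
       rule chosen_position_reaches_root[OF assms refl that(2)])
qed

lemma cgm_solvable_cnf_to_cgm_iff:
  assumes "\<Phi> \<in> cnf_instances"
  shows "cgm_solvable (cnf_to_cgm \<Phi>) \<longleftrightarrow> cnf_satisfiable \<Phi>"
  unfolding cgm_solvable_iff_cgm_solution[OF pair_graph_cnf_to_cgm]
proof
  assume "\<exists>S. cgm_solution (cnf_to_cgm \<Phi>) S"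
  then obtain S where "cgm_solution (cnf_to_cgm \<Phi>) S" by (elim exE)
  then have "\<forall>C\<in>set \<Phi>. \<exists>(x, b)\<in>set C. (x \<in> S) = b"
    by (intro ballI cgm_solution_satisfies_clause)
  then show "cnf_satisfiable \<Phi>"
    unfolding cnf_satisfiable_def by (intro exI[of _ "\<lambda>x. x \<in> S"])
next
  assume "cnf_satisfiable \<Phi>"
  then obtain \<alpha> where "\<forall>C\<in>set \<Phi>. \<exists>(x, b)\<in>set C. \<alpha> x = b"
    unfolding cnf_satisfiable_def by (elim exE)
  from cgm_solution_chosen_positions[OF assms this]
  show "\<exists>S. cgm_solution (cnf_to_cgm \<Phi>) S" by (rule exI)
qed

subsection \<open>Computing the reduction\<close>

fun enc_vertex :: "vertex \<Rightarrow> data" where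
  "enc_vertex (Literal l) = Node (enc_bool True) (enc_literal l)"
| "enc_vertex (Clause C) = Node Nl (enc_list enc_literal C)"
| "enc_vertex Root = Nl"

definition literal_eq_data :: "data \<Rightarrow> data \<Rightarrow> bool" where
  "literal_eq_data l l' \<longleftrightarrow>
     length (list_of_data (fst_data l)) = length (list_of_data (fst_data l')) \<and>
     (snd_data l = Nl \<longleftrightarrow> snd_data l' = Nl)"

definition literal_adjacent_data :: "data \<Rightarrow> data \<Rightarrow> bool" where
  "literal_adjacent_data u v \<longleftrightarrow> fst_data u \<noteq> Nl \<and> fst_data v = Nl \<and>
     (v = Nl \<or> (\<exists>l\<in>set (list_of_data (snd_data v)). literal_eq_data l (snd_data u)))"

definition adjacent_data :: "data \<Rightarrow> data \<Rightarrow> bool" where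
  "adjacent_data u v \<longleftrightarrow> literal_adjacent_data u v \<or> literal_adjacent_data v u"

definition vars_data :: "data \<Rightarrow> data list" where
  "vars_data d = map enc_nat [0..<length (list_of_data (fst_data d))]"

definition vertices_data :: "data \<Rightarrow> data list" where
  "vertices_data d = map (\<lambda>x. Node (enc_bool True) (Node x (enc_bool True))) (vars_data d)
     @ map (\<lambda>x. Node (enc_bool True) (Node x (enc_bool False))) (vars_data d)
     @ map (\<lambda>C. Node Nl C) (list_of_data (snd_data d)) @ [Nl]"

definition colors_data :: "data \<Rightarrow> data list" where
  "colors_data d =
     map enc_nat [0..<length (vars_data d @ list_of_data (snd_data d) @ [Nl])]"

definition cnf_to_cgm_data :: "data \<Rightarrow> data" where
  "cnf_to_cgm_data d = Node
     (data_of_list (map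
       (\<lambda>u. data_of_list (map (\<lambda>v. enc_bool (adjacent_data u v)) (vertices_data d)))
       (vertices_data d)))
     (Node (data_of_list (vars_data d @ colors_data d))
       (data_of_list (map (\<lambda>_. enc_bool True) (colors_data d))))"

lemmas fptime_basic = fptime_id fptime_Nl fptime_Node fptime_fst_data fptime_snd_data
  fptime_enc_bool ptime_True ptime_False

lemmas fptime_list = fptime_Nil fptime_Cons fptime_append fptime_map fptime_data_of_list_of_data

lemma ptime_literal_eq_data:
  assumes "fptime f" "fptime g"
  shows "ptime (\<lambda>d. literal_eq_data (f d) (g d))"
  unfolding literal_eq_data_def
  by (intro ptime_logic ptime_length_eq fptime_data_of_list_of_data fptime_basic assms)

lemma ptime_adjacent_data:
  assumes "fptime f" "fptime g"
  shows "ptime (\<lambda>d. adjacent_data (f d) (g d))"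
proof -
  have "ptime2 adjacent_data"
    unfolding adjacent_data_def literal_adjacent_data_def
    by (intro ptime_logic ptime_bex ptime_literal_eq_data fptime_data_of_list_of_data fptime_basic)
  from fptime_comp2[OF fptime_enc_bool[OF this] assms] show ?thesis by (simp add: ptime_def)
qed

lemma fptime_vars_data:
  assumes "fptime f"
  shows "fptime (\<lambda>d. data_of_list (vars_data (f d)))"
  unfolding vars_data_def
  by (intro fptime_upt fptime_data_of_list_of_data fptime_fst_data assms)

lemma fptime_vertices_data:
  assumes "fptime f"
  shows "fptime (\<lambda>d. data_of_list (vertices_data (f d)))"
  unfolding vertices_data_def
  by (intro fptime_list fptime_vars_data fptime_basic assms)

lemma fptime_colors_data: "fptime (\<lambda>d. data_of_list (colors_data d))"
  unfolding colors_data_def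
  by (intro fptime_upt fptime_append fptime_Nil fptime_Cons fptime_vars_data
      fptime_data_of_list_of_data fptime_basic)

lemma fptime_cnf_to_cgm_data: "fptime cnf_to_cgm_data"
  unfolding cnf_to_cgm_data_def
  by (intro fptime_list ptime_adjacent_data fptime_vertices_data fptime_vars_data fptime_colors_data
      fptime_basic)

lemma literal_eq_data_enc_literal: "literal_eq_data (enc_literal l) (enc_literal l') \<longleftrightarrow> l = l'"
  by (cases l; cases l') (simp add: literal_eq_data_def enc_literal_def enc_nat_conv_replicate)

lemma adjacent_data_enc_vertex: "adjacent_data (enc_vertex u) (enc_vertex v) \<longleftrightarrow> adjacent u v"
  by (cases u; cases v)
    (simp_all add: adjacent_data_def literal_adjacent_data_def enc_list_conv_map
      literal_eq_data_enc_literal)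

lemma vars_data_enc_cnf: "vars_data (enc_cnf \<Phi>) = map enc_nat [0..<num_vars \<Phi>]"
  by (simp add: vars_data_def enc_cnf_def enc_nat_conv_replicate[of "num_vars \<Phi>"])

lemma vertices_data_enc_cnf: "vertices_data (enc_cnf \<Phi>) = map enc_vertex (cnf_vertices \<Phi>)"
  by (simp add: vertices_data_def vars_data_enc_cnf cnf_vertices_def enc_literal_def)
    (simp add: enc_cnf_def enc_list_conv_map)

lemma colors_data_enc_cnf:
  "colors_data (enc_cnf \<Phi>) = map enc_nat [0..<num_vars \<Phi> + length \<Phi> + 1]"
  by (simp add: colors_data_def vars_data_enc_cnf del: upt_Suc)
    (simp add: enc_cnf_def enc_list_conv_map del: upt_Suc)

lemma enc_list_upt_length:
  assumes "\<And>i. i < length xs \<Longrightarrow> f i = g (xs ! i)"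
  shows "enc_list f [0..<length xs] = enc_list g xs"
  unfolding enc_list_conv_map
  by (intro arg_cong[where f = data_of_list] nth_equalityI) (simp_all add: assms)

lemma enc_list_parcs_cnf_to_cgm:
  "enc_list (\<lambda>u. enc_list (\<lambda>v. enc_bool ((u, v) \<in> parcs (cgm_graph (cnf_to_cgm \<Phi>))))
      [0..<length (cnf_vertices \<Phi>)]) [0..<length (cnf_vertices \<Phi>)]
    = enc_list (\<lambda>u. enc_list (\<lambda>v. enc_bool (adjacent u v)) (cnf_vertices \<Phi>)) (cnf_vertices \<Phi>)"
  by (intro enc_list_upt_length) (simp add: parcs_cnf_to_cgm)

lemma map_cgm_coloring_cnf_to_cgm:
  "map (cgm_coloring (cnf_to_cgm \<Phi>)) [0..<length (cnf_vertices \<Phi>)]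
    = [0..<num_vars \<Phi>] @ [0..<num_vars \<Phi> + length \<Phi> + 1]"
proof -
  let ?r = "num_vars \<Phi>" and ?k = "num_vars \<Phi> + length \<Phi> + 1"
  have "length (cnf_vertices \<Phi>) = ?k + ?r" by (simp add: length_cnf_vertices)
  moreover have "[0..<?k + ?r] = [0..<?r] @ [?r..<?k + ?r]"
    using upt_add_eq_append[of 0 ?r ?k] by (simp only: le0 add.commute)
  ultimately have "[0..<length (cnf_vertices \<Phi>)] = [0..<?r] @ map (\<lambda>i. i + ?r) [0..<?k]"
    by (simp only: map_add_upt)
  then show ?thesis
    by (auto simp: cgm_coloring_cnf_to_cgm comp_def simp del: upt_Suc intro: map_idI)
qed

lemma cnf_to_cgm_data_enc_cnf: "cnf_to_cgm_data (enc_cnf \<Phi>) = enc_cgm (cnf_to_cgm \<Phi>)"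
proof -
  let ?k = "num_vars \<Phi> + length \<Phi> + 1" and ?n = "length (cnf_vertices \<Phi>)"
  have colors: "enc_list (\<lambda>v. enc_nat (cgm_coloring (cnf_to_cgm \<Phi>) v)) [0..<?n]
      = enc_list enc_nat ([0..<num_vars \<Phi>] @ [0..<?k])"
    unfolding map_cgm_coloring_cnf_to_cgm[symmetric] by (simp add: enc_list_conv_map comp_def)
  have motif: "enc_list (\<lambda>c. enc_bool (c \<in> cgm_motif (cnf_to_cgm \<Phi>))) [0..<?k]
      = enc_list (\<lambda>_. enc_bool True) [0..<?k]"
    unfolding enc_list_conv_map cgm_motif_cnf_to_cgm
    by (intro arg_cong[where f = data_of_list] map_cong refl) (simp del: upt_Suc)
  show ?thesis
    unfolding cnf_to_cgm_data_def enc_cgm_def Let_def cgm_verts_cnf_to_cgm cgm_colors_cnf_to_cgm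
      card_lessThan enc_list_parcs_cnf_to_cgm colors motif
    by (simp add: vars_data_enc_cnf vertices_data_enc_cnf colors_data_enc_cnf
        enc_list_conv_map adjacent_data_enc_vertex comp_def)
qed

lemma ptime_reduction_cnf_to_cgm:
  "ptime_reduction cnf_instances cnf_satisfiable enc_cnf cgm_instances cgm_solvable enc_cgm
    cnf_to_cgm"
  unfolding ptime_reduction_def
  by (intro exI[of _ cnf_to_cgm_data])
    (simp add: fptime_cnf_to_cgm_data cnf_to_cgm_in_cgm_instances cnf_to_cgm_data_enc_cnf
      cgm_solvable_cnf_to_cgm_iff)

subsection \<open>Sizes\<close>

lemma num_vars_le_cnf_size: "num_vars \<Phi> \<le> cnf_size \<Phi>"
proof -
  have "num_vars \<Phi> = card (set (map fst (concat \<Phi>)))"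
    by (simp add: num_vars_def cnf_vars_def image_UN)
  also have "\<dots> \<le> (\<Sum>C\<leftarrow>\<Phi>. length C)"
    using card_length[of "map fst (concat \<Phi>)"] by (simp add: length_concat)
  also have "\<dots> \<le> cnf_size \<Phi>"
    unfolding cnf_size_def by (rule sum_list_mono) simp
  finally show ?thesis .
qed

lemma length_le_cnf_size: "length \<Phi> \<le> cnf_size \<Phi>"
  by (induction \<Phi>) (auto simp: cnf_size_def)

lemma length_clause_less_cnf_size:
  assumes "C \<in> set \<Phi>"
  shows "length C < cnf_size \<Phi>"
  using member_le_sum_list[of "length C + 1" "map (\<lambda>C. length C + 1) \<Phi>"] assms
  by (auto simp: cnf_size_def)

lemma size_enc_list_le:
  assumes "\<And>x. x \<in> set xs \<Longrightarrow> size (f x) \<le> B"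
  shows "size (enc_list f xs) \<le> length xs * (B + 1)"
  using assms
proof (induction xs)
  case (Cons x xs)
  then have "size (enc_list f xs) \<le> length xs * (B + 1)" "size (f x) \<le> B" by auto
  then show ?case by simp
qed simp

lemma size_enc_cnf_le:
  assumes "\<Phi> \<in> cnf_instances"
  shows "size (enc_cnf \<Phi>) \<le> poly [:1, 2, 3, 1:] (cnf_size \<Phi>)"
proof -
  let ?n = "cnf_size \<Phi>"
  have literal: "size (enc_literal l) \<le> ?n + 2" if "C \<in> set \<Phi>" "l \<in> set C" for C l
  proof -
    have "fst l < num_vars \<Phi>"
      using var_less_num_vars[OF assms \<open>C \<in> set \<Phi>\<close>, of "fst l" "snd l"] that by simp
    moreover have "size (enc_bool (snd l)) \<le> 1" by (cases "snd l") auto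
    ultimately show ?thesis using num_vars_le_cnf_size[of \<Phi>] by (simp add: enc_literal_def)
  qed
  have clause: "size (enc_list enc_literal C) \<le> ?n * (?n + 3)" if "C \<in> set \<Phi>" for C
  proof -
    have "size (enc_list enc_literal C) \<le> length C * (?n + 2 + 1)"
      using literal[OF that] by (rule size_enc_list_le)
    also have "\<dots> \<le> ?n * (?n + 3)"
      using length_clause_less_cnf_size[OF that] by (intro mult_le_mono) auto
    finally show ?thesis .
  qed
  have "size (enc_list (enc_list enc_literal) \<Phi>) \<le> length \<Phi> * (?n * (?n + 3) + 1)"
    using clause by (rule size_enc_list_le)
  also have "\<dots> \<le> ?n * (?n * (?n + 3) + 1)"
    using length_le_cnf_size by (rule mult_le_mono1)
  finally show ?thesis
    using num_vars_le_cnf_size[of \<Phi>] by (simp add: enc_cnf_def algebra_simps)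
qed

lemma card_cgm_verts_cnf_to_cgm_le: "card (cgm_verts (cnf_to_cgm \<Phi>)) \<le> poly [:1, 3:] (cnf_size \<Phi>)"
  using num_vars_le_cnf_size[of \<Phi>] length_le_cnf_size[of \<Phi>]
  by (simp add: cgm_verts_cnf_to_cgm length_cnf_vertices)

lemma cnf_solvable_with_base_if_cgm:
  assumes "1 \<le> b"
    and "solvable_with_base cgm_instances cgm_solvable enc_cgm cgm_param (\<lambda>I. card (cgm_verts I)) b"
  shows "solvable_with_base cnf_instances cnf_satisfiable enc_cnf num_vars cnf_size b"
  by (rule solvable_with_base_ptime_reduction[OF ptime_reduction_cnf_to_cgm _ size_enc_cnf_le
        card_cgm_verts_cnf_to_cgm_le assms]) (simp_all add: cgm_param_cnf_to_cgm)

theorem theorem2: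
  assumes "SETH"
  shows "\<not> (\<exists>\<epsilon>::real. \<epsilon> > 0 \<and> (\<exists>q :: nat poly.
    solvable_within cgm_instances cgm_solvable enc_cgm
      (\<lambda>I. (2 - \<epsilon>) ^ cgm_param I * real (poly q (card (cgm_verts I))))))"
proof (rule notI, elim exE conjE)
  fix \<epsilon> :: real and q :: "nat poly"
  let ?cgm_solvable_with_base = "solvable_with_base cgm_instances cgm_solvable enc_cgm cgm_param
    (\<lambda>I. card (cgm_verts I))"
  assume "\<epsilon> > 0" and "solvable_within cgm_instances cgm_solvable enc_cgm
      (\<lambda>I. (2 - \<epsilon>) ^ cgm_param I * real (poly q (card (cgm_verts I))))"
  then have solvable: "?cgm_solvable_with_base (2 - \<epsilon>)"
    unfolding solvable_with_base_def by (intro exI)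
  define \<delta> where "\<delta> = min \<epsilon> 1" \<comment> \<open>a base of at least \<open>1\<close> absorbs the cost of the reduction\<close>
  have "odd (cgm_param (cnf_to_cgm [[(0, True)]]))"
    by (simp add: cgm_param_cnf_to_cgm num_vars_def cnf_vars_def)
  then have "0 < 2 - \<epsilon>"
    using solvable_with_base_imp_pos[OF solvable cnf_to_cgm_in_cgm_instances] by blast
  then have "?cgm_solvable_with_base (2 - \<delta>)"
    by (intro solvable_with_base_mono[OF solvable]) (simp_all add: \<delta>_def)
  then have "solvable_with_base cnf_instances cnf_satisfiable enc_cnf num_vars cnf_size (2 - \<delta>)"
    by (rule cnf_solvable_with_base_if_cgm[rotated]) (simp add: \<delta>_def)
  moreover have "\<delta> > 0" using \<open>\<epsilon> > 0\<close> by (simp add: \<delta>_def)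
  ultimately show False using assms unfolding SETH_def solvable_with_base_def by simp
qed

end
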